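(* Let $r$ be a positive integer and $\varepsilon\in(0,\sqrt2/12)$. Given a known quantum state $\sigma$ of rank $r$ and copies of an unknown quantum state $\rho$ promised to have rank at most $r$, any quantum algorithm estimating $\mathrm{H}(\rho,\sigma)$ within additive error $\varepsilon$ (with success probability at least $2/3$) requires $\Omega(r/\varepsilon^2)$ samples of $\rho$.
   Context: $\mathrm{H}(\rho,\sigma)=\sqrt{\tfrac12\operatorname{tr}\big((\sqrt\rho-\sqrt\sigma)^2\big)}=\sqrt{1-\operatorname{tr}(\sqrt\rho\sqrt\sigma)}$. *)

theory Defs
  imports "Jordan_Normal_Form.DL_Rank" "Jordan_Normal_Form.Matrix"
begin

definition cadj :: "complex mat \<Rightarrow> complex mat" where
  "cadj A = mat (dim_col A) (dim_row A) (\<lambda>(i,j). cnj (A $$ (j,i)))"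

definition mtrace :: "complex mat \<Rightarrow> complex" where
  "mtrace A = (\<Sum>i<dim_row A. A $$ (i,i))"

definition psd :: "nat \<Rightarrow> complex mat \<Rightarrow> bool" where
  "psd d A \<longleftrightarrow> A \<in> carrier_mat d d \<and> cadj A = A \<and>
     (\<forall>v \<in> carrier_vec d. (let q = (\<Sum>i<d. cnj (v $ i) * (A *\<^sub>v v) $ i) in Im q = 0 \<and> Re q \<ge> 0))"

definition density :: "nat \<Rightarrow> complex mat \<Rightarrow> bool" where
  "density d \<rho> \<longleftrightarrow> psd d \<rho> \<and> mtrace \<rho> = 1"

definition crank :: "complex mat \<Rightarrow> nat" where
  "crank A = vec_space.rank (dim_row A) A"

definition msqrt :: "complex mat \<Rightarrow> complex mat" where
  "msqrt A = (THE B. psd (dim_row A) B \<and> B * B = A)"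

definition hellinger :: "complex mat \<Rightarrow> complex mat \<Rightarrow> real" where
  "hellinger \<rho> \<sigma> = sqrt (1 - Re (mtrace (msqrt \<rho> * msqrt \<sigma>)))"

(* n-fold tensor power of a d x d matrix; basis index i of (C^d)^{\<otimes>n} encoded in base d *)
definition tensor_pow :: "nat \<Rightarrow> nat \<Rightarrow> complex mat \<Rightarrow> complex mat" where
  "tensor_pow d n \<rho> = mat (d ^ n) (d ^ n)
     (\<lambda>(i,j). \<Prod>k<n. \<rho> $$ ((i div d ^ k) mod d, (j div d ^ k) mod d))"

definition povm :: "nat \<Rightarrow> nat \<Rightarrow> (nat \<Rightarrow> complex mat) \<Rightarrow> bool" where
  "povm D m E \<longleftrightarrow> (\<forall>k<m. psd D (E k)) \<and>
     (\<forall>i<D. \<forall>j<D. (\<Sum>k<m. E k $$ (i,j)) = (1\<^sub>m D) $$ (i,j))"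

(* A quantum algorithm using n copies of rho: a POVM (E k)_{k<m} on rho^{\<otimes>n}, outcome k
   yielding the estimate est k.  It estimates H(rho,sigma) within eps with success probability
   at least 2/3 for every state rho on C^d of rank at most r. *)
definition hellinger_estimator ::
  "nat \<Rightarrow> complex mat \<Rightarrow> nat \<Rightarrow> real \<Rightarrow> nat \<Rightarrow> nat \<Rightarrow> (nat \<Rightarrow> complex mat) \<Rightarrow> (nat \<Rightarrow> real) \<Rightarrow> bool"
  where
  "hellinger_estimator d \<sigma> r \<epsilon> n m E est \<longleftrightarrow> povm (d ^ n) m E \<and>
     (\<forall>\<rho>. density d \<rho> \<and> crank \<rho> \<le> r \<longrightarrow>
        (\<Sum>k\<in>{k. k < m \<and> \<bar>est k - hellinger \<rho> \<sigma>\<bar> \<le> \<epsilon>}.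
            Re (mtrace (E k * tensor_pow d n \<rho>))) \<ge> 2/3)"

end

theory Submission
  imports Defs "HOL-Combinatorics.Permutations"
begin

text \<open>For \<open>r \<ge> 2\<close> take \<open>\<sigma> = I/r\<close> and hide the direction of the perturbation \<open>\<rho> = (I + \<delta> X)/r\<close>,
  \<open>\<delta> = 7\<epsilon>\<close>, in the permutation matrix \<open>X\<close> of a perfect matching between two blocks of
  \<open>p = r div 2\<close> basis vectors, given by a uniformly random permutation \<open>\<pi>\<close> of \<open>p\<close> points (an odd last
  coordinate is left alone). All these \<open>\<rho>\<close> have the same Hellinger distance to \<open>\<sigma>\<close>, larger than
  \<open>2\<epsilon>\<close>, so an estimator distinguishes \<open>\<sigma>\<^sup>\<otimes>\<^sup>n\<close> from the average of the \<open>\<rho>\<^sup>\<otimes>\<^sup>n\<close>. The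
  \<open>\<chi>\<^sup>2\<close>-divergence of that average from \<open>\<sigma>\<^sup>\<otimes>\<^sup>n\<close> is the mean of
  \<open>(1 + 2 \<delta>\<^sup>2 A / r)\<^sup>n - 1\<close>, where \<open>A\<close> is the number of points on which two independent
  permutations agree. As \<open>A\<close> is dominated by a Poisson variable of mean \<open>1\<close> in its factorial moments, this stays
  below \<open>1/3\<close> unless \<open>n\<close> is of order \<open>r / \<delta>\<^sup>2\<close>. For \<open>r = 1\<close> all states are pure, and two pure
  states at Hellinger distance \<open>3\<epsilon>\<close> need \<open>n\<close> of order \<open>1 / \<epsilon>\<^sup>2\<close>.\<close>

section \<open>Positive semidefinite matrices\<close>

text \<open>Vectors are plain functions of which only the values below \<open>d\<close> matter,
  which avoids carrier conditions.\<close>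

definition qform :: "nat \<Rightarrow> complex mat \<Rightarrow> (nat \<Rightarrow> complex) \<Rightarrow> complex" where
  "qform d A v = (\<Sum>i<d. \<Sum>j<d. cnj (v i) * A $$ (i,j) * v j)"

lemma qform_hermitian_real:
  assumes "\<And>i j. i < d \<Longrightarrow> j < d \<Longrightarrow> cnj (A $$ (i,j)) = A $$ (j,i)"
  shows "Im (qform d A v) = 0"
proof -
  have "cnj (qform d A v) = (\<Sum>i<d. \<Sum>j<d. v i * cnj (A $$ (i,j)) * cnj (v j))"
    unfolding qform_def by simp
  also have "\<dots> = (\<Sum>j<d. \<Sum>i<d. v i * cnj (A $$ (i,j)) * cnj (v j))"
    by (rule sum.swap)
  also have "\<dots> = qform d A v"
    unfolding qform_def
  proof (intro sum.cong refl)
    fix i j assume "i \<in> {..<d}" "j \<in> {..<d}"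
    then show "v j * cnj (A $$ (j,i)) * cnj (v i) = cnj (v i) * A $$ (i,j) * v j"
      by (simp add: mult_ac assms)
  qed
  finally show ?thesis by (metis Reals_cnj_iff complex_is_Real_iff)
qed

text \<open>Hermitian symmetry makes the form real, so positivity concerns its real part only. Later
  positivity arguments all work with entries in this shape.\<close>

lemma psd_iff:
  "psd d A \<longleftrightarrow> A \<in> carrier_mat d d \<and> (\<forall>i<d. \<forall>j<d. cnj (A $$ (i,j)) = A $$ (j,i)) \<and>
    (\<forall>v. 0 \<le> Re (qform d A v))" (is "_ \<longleftrightarrow> ?R")
proof -
  have q: "(\<Sum>i<d. cnj (w $ i) * (A *\<^sub>v w) $ i) = qform d A (\<lambda>i. w $ i)"
    if "A \<in> carrier_mat d d" "w \<in> carrier_vec d" for w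
    unfolding qform_def using that
    by (intro sum.cong refl)
      (auto simp: scalar_prod_def sum_distrib_left mult_ac atLeast0LessThan intro!: sum.cong)
  have h: "cadj A = A \<longleftrightarrow> (\<forall>i<d. \<forall>j<d. cnj (A $$ (i,j)) = A $$ (j,i))"
    if A: "A \<in> carrier_mat d d"
  proof
    assume "cadj A = A"
    moreover have "cadj A $$ (j,i) = cnj (A $$ (i,j))" if "i < d" "j < d" for i j
      using A that by (simp add: cadj_def)
    ultimately show "\<forall>i<d. \<forall>j<d. cnj (A $$ (i,j)) = A $$ (j,i)"
      by metis
  next
    assume "\<forall>i<d. \<forall>j<d. cnj (A $$ (i,j)) = A $$ (j,i)"
    then show "cadj A = A" using A by (auto simp: cadj_def intro!: eq_matI)
  qed
  show ?thesis
  proof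
    assume P: "psd d A"
    then have A: "A \<in> carrier_mat d d" by (simp add: psd_def)
    have "0 \<le> Re (qform d A v)" for v
    proof -
      have "qform d A v = qform d A (\<lambda>i. vec d v $ i)"
        by (simp add: qform_def)
      moreover have "0 \<le> Re (\<Sum>i<d. cnj (vec d v $ i) * (A *\<^sub>v vec d v) $ i)"
        using P unfolding psd_def Let_def by (metis vec_carrier)
      ultimately show ?thesis using q[OF A, of "vec d v"] by (simp only: vec_carrier)
    qed
    moreover have "\<forall>i<d. \<forall>j<d. cnj (A $$ (i,j)) = A $$ (j,i)"
      using P h[OF A] unfolding psd_def by blast
    ultimately show ?R using A by blast
  next
    assume R: ?R
    then have A: "A \<in> carrier_mat d d" by simp
    show "psd d A"
      unfolding psd_def Let_def
    proof (intro conjI ballI)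
      have H: "\<And>i j. i < d \<Longrightarrow> j < d \<Longrightarrow> cnj (A $$ (i,j)) = A $$ (j,i)" using R by blast
      then show "cadj A = A" using h[OF A] by blast
      fix v :: "complex vec" assume v: "v \<in> carrier_vec d"
      show "Im (\<Sum>i<d. cnj (v $ i) * (A *\<^sub>v v) $ i) = 0"
        unfolding q[OF A v] by (rule qform_hermitian_real[OF H])
      show "0 \<le> Re (\<Sum>i<d. cnj (v $ i) * (A *\<^sub>v v) $ i)"
        unfolding q[OF A v] using R by blast
    qed (rule A)
  qed
qed

lemma psd_carrier: "psd d A \<Longrightarrow> A \<in> carrier_mat d d"
  by (simp add: psd_iff)

lemma psd_hermitian: "psd d A \<Longrightarrow> i < d \<Longrightarrow> j < d \<Longrightarrow> cnj (A $$ (i,j)) = A $$ (j,i)"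
  by (simp add: psd_iff)

lemma psd_qform_nonneg: "psd d A \<Longrightarrow> 0 \<le> Re (qform d A v)"
  by (simp add: psd_iff)

lemma mult_mat_index:
  assumes "A \<in> carrier_mat d d" "B \<in> carrier_mat d d" "i < d" "j < d"
  shows "(A * B) $$ (i,j) = (\<Sum>k<d. A $$ (i,k) * B $$ (k,j))"
  using assms by (auto simp: scalar_prod_def atLeast0LessThan intro!: sum.cong)

lemma mtrace_mult:
  assumes "A \<in> carrier_mat d d" "B \<in> carrier_mat d d"
  shows "mtrace (A * B) = (\<Sum>i<d. \<Sum>j<d. A $$ (i,j) * B $$ (j,i))"
  unfolding mtrace_def using assms
  by (auto simp: scalar_prod_def atLeast0LessThan intro!: sum.cong)

lemma mtrace_comm:
  assumes "A \<in> carrier_mat d d" "B \<in> carrier_mat d d"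
  shows "mtrace (A * B) = mtrace (B * A)"
proof -
  have "mtrace (A * B) = (\<Sum>j<d. \<Sum>i<d. A $$ (i,j) * B $$ (j,i))"
    unfolding mtrace_mult[OF assms] by (rule sum.swap)
  then show ?thesis
    unfolding mtrace_mult[OF assms(2,1)] by (simp only: mult.commute)
qed

text \<open>For Hermitian \<open>C\<close> the form of \<open>C * C\<close> at \<open>v\<close> is
  the squared norm of \<open>C v\<close>. Every concrete state below is shown positive by exhibiting
  it as such a square.\<close>

lemma psd_square:
  assumes C: "C \<in> carrier_mat d d"
    and h: "\<And>i j. i < d \<Longrightarrow> j < d \<Longrightarrow> cnj (C $$ (i,j)) = C $$ (j,i)"
  shows "psd d (C * C)"
proof -
  have hh: "(C * C) $$ (i,j) = (\<Sum>k<d. cnj (C $$ (k,i)) * C $$ (k,j))" if "i < d" "j < d" for i j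
    unfolding mult_mat_index[OF C C that] using h that by (intro sum.cong) auto
  have "qform d (C * C) v = (\<Sum>k<d. cnj (\<Sum>i<d. C $$ (k,i) * v i) * (\<Sum>j<d. C $$ (k,j) * v j))" for v
  proof -
    have "qform d (C * C) v
      = (\<Sum>i<d. \<Sum>j<d. \<Sum>k<d. cnj (C $$ (k,i) * v i) * (C $$ (k,j) * v j))"
      unfolding qform_def
      by (intro sum.cong refl) (simp add: hh sum_distrib_left sum_distrib_right mult_ac)
    also have "\<dots> = (\<Sum>i<d. \<Sum>k<d. \<Sum>j<d. cnj (C $$ (k,i) * v i) * (C $$ (k,j) * v j))"
      by (intro sum.cong refl sum.swap)
    also have "\<dots> = (\<Sum>k<d. \<Sum>i<d. \<Sum>j<d. cnj (C $$ (k,i) * v i) * (C $$ (k,j) * v j))"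
      by (rule sum.swap)
    finally show ?thesis by (simp add: sum_product)
  qed
  then have "qform d (C * C) v = of_real (\<Sum>k<d. (cmod (\<Sum>i<d. C $$ (k,i) * v i))\<^sup>2)" for v
    by (simp only: of_real_sum complex_norm_square mult.commute[of "cnj _"])
  then have "0 \<le> Re (qform d (C * C) v)" for v
    by (simp only: Re_complex_of_real) (simp add: sum_nonneg)
  moreover have "cnj ((C * C) $$ (i,j)) = (C * C) $$ (j,i)" if "i < d" "j < d" for i j
    using that by (simp add: hh mult.commute)
  ultimately show ?thesis using C by (auto simp: psd_iff)
qed

text \<open>Applied with \<open>y = A x\<close>, this single expansion replaces Cauchy--Schwarz for the form of
  \<open>A\<close>.\<close>

lemma qform_diff:
  assumes "\<And>i j. i < d \<Longrightarrow> j < d \<Longrightarrow> cnj (A $$ (i,j)) = A $$ (j,i)"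
  shows "Re (qform d A (\<lambda>i. x i - of_real t * y i)) =
    Re (qform d A x) - 2 * t * Re (\<Sum>i<d. \<Sum>j<d. cnj (y i) * A $$ (i,j) * x j) + t\<^sup>2 * Re (qform d A y)"
proof -
  let ?b = "\<lambda>x y. \<Sum>i<d. \<Sum>j<d. cnj (y i) * A $$ (i,j) * x j"
  have sw: "cnj (?b y x) = ?b x y"
  proof -
    have "cnj (?b y x) = (\<Sum>i<d. \<Sum>j<d. x i * cnj (A $$ (i,j)) * cnj (y j))" by simp
    also have "\<dots> = (\<Sum>j<d. \<Sum>i<d. x i * cnj (A $$ (i,j)) * cnj (y j))" by (rule sum.swap)
    also have "\<dots> = ?b x y"
    proof (intro sum.cong refl)
      fix i j assume "i \<in> {..<d}" "j \<in> {..<d}"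
      then show "x j * cnj (A $$ (j,i)) * cnj (y i) = cnj (y i) * A $$ (i,j) * x j"
        by (simp add: mult_ac assms)
    qed
    finally show ?thesis .
  qed
  have "qform d A (\<lambda>i. x i - of_real t * y i) =
     qform d A x - of_real t * ?b y x - of_real t * ?b x y + of_real (t\<^sup>2) * qform d A y"
  proof -
    have "cnj (x i - of_real t * y i) * A $$ (i,j) * (x j - of_real t * y j)
      = cnj (x i) * A $$ (i,j) * x j - of_real t * (cnj (x i) * A $$ (i,j) * y j)
        - of_real t * (cnj (y i) * A $$ (i,j) * x j) + of_real (t\<^sup>2) * (cnj (y i) * A $$ (i,j) * y j)" for i j
      by (simp add: algebra_simps power2_eq_square)
    then show ?thesis
      unfolding qform_def by (simp only: sum.distrib sum_subtractf sum_distrib_left)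
  qed
  moreover have "Re (?b y x) = Re (?b x y)"
    using arg_cong[OF sw, of Re] by (simp only: cnj.sel(1))
  ultimately show ?thesis by simp
qed

lemma qform_apply:
  "(\<Sum>i<d. \<Sum>j<d. cnj (\<Sum>k<d. A $$ (i,k) * x k) * A $$ (i,j) * x j)
    = of_real (\<Sum>i<d. (cmod (\<Sum>k<d. A $$ (i,k) * x k))\<^sup>2)"
proof -
  have "(\<Sum>j<d. cnj (\<Sum>k<d. A $$ (i,k) * x k) * A $$ (i,j) * x j)
     = cnj (\<Sum>k<d. A $$ (i,k) * x k) * (\<Sum>j<d. A $$ (i,j) * x j)" for i
    by (simp only: sum_distrib_left mult.assoc)
  then show ?thesis
    by (simp only: of_real_sum complex_norm_square mult.commute[of "cnj _"])
qed

lemma qform_diff_apply: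
  assumes "\<And>i j. i < d \<Longrightarrow> j < d \<Longrightarrow> cnj (A $$ (i,j)) = A $$ (j,i)"
  shows "Re (qform d A (\<lambda>i. x i - of_real t * (\<Sum>k<d. A $$ (i,k) * x k))) =
    Re (qform d A x) - 2 * t * (\<Sum>i<d. (cmod (\<Sum>k<d. A $$ (i,k) * x k))\<^sup>2)
      + t\<^sup>2 * Re (qform d A (\<lambda>i. \<Sum>k<d. A $$ (i,k) * x k))"
proof -
  have "Re (qform d A (\<lambda>i. x i - of_real t * (\<Sum>k<d. A $$ (i,k) * x k))) =
    Re (qform d A x)
      - 2 * t * Re (\<Sum>i<d. \<Sum>j<d. cnj (\<Sum>k<d. A $$ (i,k) * x k) * A $$ (i,j) * x j)
      + t\<^sup>2 * Re (qform d A (\<lambda>i. \<Sum>k<d. A $$ (i,k) * x k))"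
    by (rule qform_diff[OF assms])
  then show ?thesis by (simp only: qform_apply Re_complex_of_real)
qed

text \<open>Moving from \<open>x\<close> by \<open>- t A x\<close> changes the form by
  \<open>- 2 * t * N + t^2 * Q\<close>, with \<open>N\<close> the squared norm of
  \<open>A x\<close>. For small positive \<open>t\<close> this would be negative unless
  \<open>A x = 0\<close>.\<close>

lemma psd_qform_zero:
  assumes A: "psd d A" and z: "Re (qform d A x) = 0" and i: "i < d"
  shows "(\<Sum>k<d. A $$ (i,k) * x k) = 0"
proof -
  let ?y = "\<lambda>i. \<Sum>k<d. A $$ (i,k) * x k"
  define N where "N = (\<Sum>i<d. (cmod (?y i))\<^sup>2)"
  define Q where "Q = Re (qform d A ?y)"
  have N0: "N \<ge> 0" unfolding N_def by (simp add: sum_nonneg)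
  have Q0: "Q \<ge> 0" unfolding Q_def by (rule psd_qform_nonneg[OF A])
  have ineq: "0 \<le> - 2 * t * N + t\<^sup>2 * Q" for t
    using psd_qform_nonneg[OF A, of "\<lambda>i. x i - of_real t * ?y i"]
    by (subst (asm) qform_diff_apply) (simp_all add: psd_hermitian[OF A] z N_def Q_def)
  have "N = 0"
  proof (rule ccontr)
    assume "N \<noteq> 0"
    with N0 have "N > 0" by simp
    \<comment> \<open>This choice gives \<open>t * Q \<le> N\<close>, against
      \<open>2 * N \<le> t * Q\<close>; the \<open>+ 1\<close> covers \<open>Q = 0\<close>.\<close>
    define t where "t = N / (Q + 1)"
    have t: "t > 0" "t * Q \<le> N" using Q0 \<open>N > 0\<close> by (auto simp: t_def field_simps)
    have "t * (2 * N) \<le> t * (t * Q)" using ineq[of t] by (simp add: power2_eq_square)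
    then show False using t \<open>N > 0\<close> by simp
  qed
  then have "(cmod (?y i))\<^sup>2 = 0"
    unfolding N_def using i by (subst (asm) sum_nonneg_eq_0_iff) auto
  then show ?thesis by simp
qed

text \<open>With \<open>D = B - C\<close>, equality of the squares gives
  \<open>(B + C) D + D (B + C) = 0\<close>, so the trace of \<open>D (B + C) D\<close> vanishes. It
  is a sum of nonnegative forms of \<open>B\<close> and \<open>C\<close> at the columns of
  \<open>D\<close>; each is therefore zero, whence \<open>B D = C D = 0\<close>,
  \<open>D * D = 0\<close> and \<open>D = 0\<close>.\<close>

lemma psd_sqrt_unique:
  assumes B: "psd d B" and C: "psd d C" and e: "B * B = C * C"
  shows "B = C"
proof -
  note cB = psd_carrier[OF B] and cC = psd_carrier[OF C]
  define D where "D = B - C"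
  have cD: "D \<in> carrier_mat d d" using cB cC by (simp add: D_def minus_carrier_mat)
  have Dij: "D $$ (i,j) = B $$ (i,j) - C $$ (i,j)" if "i < d" "j < d" for i j
    using that cB cC by (simp add: D_def)
  have Dh: "cnj (D $$ (i,j)) = D $$ (j,i)" if "i < d" "j < d" for i j
    using that psd_hermitian[OF B, of i j] psd_hermitian[OF C, of i j] by (simp add: Dij)
  have eq: "(B + C) * D + D * (B + C) = 0\<^sub>m d d"
  proof -
    have "(B + C) * D = B * B - B * C + (C * B - C * C)"
      unfolding D_def using cB cC 
      by (subst add_mult_distrib_mat[of _ d d _ _ d]) (auto simp: minus_carrier_mat mult_minus_distrib_mat[of _ d d])
    moreover have "D * (B + C) = B * B + B * C - (C * B + C * C)"
      unfolding D_def using cB cC 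
      by (subst minus_mult_distrib_mat[of _ d d _ _ d]) (auto simp: mult_add_distrib_mat[of _ d d])
    ultimately show ?thesis using cB cC e by (auto intro!: eq_matI)
  qed
  \<comment> \<open>As \<open>D\<close> is Hermitian, conjugated columns are rows, and the trace
    collects the form of \<open>A\<close> over all columns.\<close>
  have qf: "(\<Sum>l<d. qform d A (\<lambda>k. D $$ (k,l))) = mtrace (D * (A * D))" if cA: "A \<in> carrier_mat d d" for A
  proof -
    have "mtrace (D * (A * D)) = (\<Sum>l<d. \<Sum>i<d. D $$ (l,i) * (\<Sum>j<d. A $$ (i,j) * D $$ (j,l)))"
      using cA cD by (subst mtrace_mult[of _ d]) (auto simp: mult_mat_index[of _ d] simp del: index_mult_mat intro!: sum.cong)
    also have "\<dots> = (\<Sum>l<d. qform d A (\<lambda>k. D $$ (k,l)))"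
      unfolding qform_def using Dh by (auto intro!: sum.cong simp: sum_distrib_left mult.assoc)
    finally show ?thesis by simp
  qed
  have tc: "mtrace (D * (D * A)) = mtrace (D * (A * D))" if cA: "A \<in> carrier_mat d d" for A
  proof -
    have "mtrace (D * (D * A)) = mtrace ((D * A) * D)"
      using cA cD by (intro mtrace_comm[of _ d]) auto
    then show ?thesis using cA cD by simp
  qed
  have tadd: "mtrace (X + Y) = mtrace X + mtrace Y" if "X \<in> carrier_mat d d" "Y \<in> carrier_mat d d" for X Y
    using that by (simp add: mtrace_def sum.distrib)
  have "0 = mtrace (D * ((B + C) * D + D * (B + C)))"
    unfolding eq using cD by (simp add: mtrace_def)
  also have "\<dots> = mtrace (D * ((B + C) * D)) + mtrace (D * (D * (B + C)))"
    using cB cC cD by (subst mult_add_distrib_mat[of _ d d _ d])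
      (auto intro!: tadd mult_carrier_mat[of _ d d])
  also have "\<dots> = 2 * mtrace (D * ((B + C) * D))" using cB cC by (simp add: tc)
  also have "\<dots> = 2 * (mtrace (D * (B * D)) + mtrace (D * (C * D)))"
    using cB cC cD by (subst add_mult_distrib_mat[of _ d d _ _ d], simp, simp, simp,
        subst mult_add_distrib_mat[of _ d d _ d])
      (auto intro!: tadd mult_carrier_mat[of _ d d] simp del: distrib_left_numeral)
  finally have "(\<Sum>l<d. Re (qform d B (\<lambda>k. D $$ (k,l)))) + (\<Sum>l<d. Re (qform d C (\<lambda>k. D $$ (k,l)))) = 0"
    unfolding Re_sum[symmetric] qf[OF cB] qf[OF cC] plus_complex.simps(1)[symmetric]
    by (metis mult_zero_right no_zero_divisors zero_complex.simps(1) zero_neq_numeral)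
  moreover have "(\<Sum>l<d. Re (qform d B (\<lambda>k. D $$ (k,l)))) \<ge> 0" "(\<Sum>l<d. Re (qform d C (\<lambda>k. D $$ (k,l)))) \<ge> 0"
    by (auto intro!: sum_nonneg psd_qform_nonneg[OF B] psd_qform_nonneg[OF C])
  ultimately have "(\<Sum>l<d. Re (qform d B (\<lambda>k. D $$ (k,l)))) = 0" "(\<Sum>l<d. Re (qform d C (\<lambda>k. D $$ (k,l)))) = 0"
    by linarith+
  then have zB: "Re (qform d B (\<lambda>k. D $$ (k,l))) = 0" and zC: "Re (qform d C (\<lambda>k. D $$ (k,l))) = 0" if "l < d" for l
    using that psd_qform_nonneg[OF B] psd_qform_nonneg[OF C]
    by (simp_all add: sum_nonneg_eq_0_iff del: Re_sum)
  have "D $$ (i,l) = 0" if i: "i < d" and l: "l < d" for i l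
  proof -
    have "(\<Sum>k<d. D $$ (l,k) * D $$ (k,l)) = 0"
      using psd_qform_zero[OF B zB[OF l] l] psd_qform_zero[OF C zC[OF l] l] l
      by (simp add: Dij[OF l] left_diff_distrib sum_subtractf)
    also have "(\<Sum>k<d. D $$ (l,k) * D $$ (k,l)) = of_real (\<Sum>k<d. (cmod (D $$ (k,l)))\<^sup>2)"
      unfolding of_real_sum complex_norm_square using Dh[OF _ l]
      by (intro sum.cong refl) (simp add: mult.commute)
    finally have "(\<Sum>k<d. (cmod (D $$ (k,l)))\<^sup>2) = 0" using of_real_eq_0_iff by blast
    then show ?thesis using i by (simp add: sum_nonneg_eq_0_iff)
  qed
  then show ?thesis using cB cC Dij by (intro eq_matI) auto
qed

text \<open>Uniqueness resolves the definite description, so a square root is computed by exhibiting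
  one.\<close>

lemma msqrt_eqI:
  assumes "psd d B" and "B * B = A"
  shows "msqrt A = B"
proof -
  have "dim_row A = d" using assms psd_carrier by fastforce
  then show ?thesis unfolding msqrt_def
    using assms psd_sqrt_unique[of d] by (intro the_equality) auto
qed

lemma qform_basis:
  assumes "l < d"
  shows "qform d A (\<lambda>i. if i = l then 1 else 0) = A $$ (l,l)"
proof -
  have "qform d A (\<lambda>i. if i = l then 1 else 0)
      = (\<Sum>i<d. if i = l then (\<Sum>j<d. if j = l then A $$ (i,j) else 0) else 0)"
    unfolding qform_def
  proof (rule sum.cong[OF refl])
    fix i
    show "(\<Sum>j<d. cnj (if i = l then 1 else 0) * A $$ (i,j) * (if j = l then 1 else 0))
        = (if i = l then (\<Sum>j<d. if j = l then A $$ (i,j) else 0) else 0)"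
      by (cases "i = l") (simp_all add: if_distrib[of "\<lambda>c. _ * c"] cong: if_cong)
  qed
  then show ?thesis using assms by simp
qed

lemma psd_mtrace_nonneg:
  assumes "psd d A"
  shows "0 \<le> Re (mtrace A)"
proof -
  have "0 \<le> Re (A $$ (l,l))" if "l < d" for l
    using psd_qform_nonneg[OF assms] qform_basis[OF that, of A] by metis
  then show ?thesis using psd_carrier[OF assms] by (auto simp: mtrace_def intro!: sum_nonneg)
qed

text \<open>This is the trace of \<open>F * F \<le> F\<close> for \<open>0 \<le> F \<le> I\<close>,
  one column at a time: the form is nonnegative at \<open>e - F e\<close> and at most the squared
  norm at \<open>F e\<close>, for each basis vector \<open>e\<close>.\<close>

lemma psd_trace_square_le:
  assumes F: "psd d F" and le: "\<And>x. Re (qform d F x) \<le> (\<Sum>i<d. (cmod (x i))\<^sup>2)"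
  shows "(\<Sum>i<d. \<Sum>j<d. (cmod (F $$ (i,j)))\<^sup>2) \<le> Re (mtrace F)"
proof -
  have "(\<Sum>i<d. (cmod (F $$ (i,l)))\<^sup>2) \<le> Re (F $$ (l,l))" if l: "l < d" for l
  proof -
    let ?x = "\<lambda>i. if i = l then 1 else 0 :: complex"
    have s: "(\<Sum>k<d. F $$ (i,k) * ?x k) = F $$ (i,l)" for i
      using l by (simp add: if_distrib cong: if_cong)
    have q: "qform d F ?x = F $$ (l,l)" by (rule qform_basis[OF l])
    have "0 \<le> Re (qform d F ?x) - 2 * (\<Sum>i<d. (cmod (F $$ (i,l)))\<^sup>2) + Re (qform d F (\<lambda>i. F $$ (i,l)))"
      using psd_qform_nonneg[OF F, of "\<lambda>i. ?x i - of_real 1 * (\<Sum>k<d. F $$ (i,k) * ?x k)"]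
      by (subst (asm) qform_diff_apply) (simp_all only: psd_hermitian[OF F] s, simp)
    then show ?thesis using q le[of "\<lambda>i. F $$ (i,l)"] by simp
  qed
  then have "(\<Sum>l<d. \<Sum>i<d. (cmod (F $$ (i,l)))\<^sup>2) \<le> (\<Sum>l<d. Re (F $$ (l,l)))"
    by (intro sum_mono) auto
  then show ?thesis using psd_carrier[OF F] sum.swap[of "\<lambda>i j. (cmod (F $$ (i,j)))\<^sup>2" "{..<d}" "{..<d}"]
    by (simp add: mtrace_def)
qed

section \<open>Tensor powers and hypothesis tests\<close>

text \<open>Numbers below \<open>d ^ n\<close> are the digit tuples of length \<open>n\<close>, so
  this expands a product of sums. The induction splits off the lowest digit,
  \<open>i = a + j * d\<close>.\<close>

lemma sum_prod_digits:
  fixes f :: "nat \<Rightarrow> nat \<Rightarrow> 'a::comm_semiring_1"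
  shows "(\<Sum>i<d ^ n. \<Prod>k<n. f k ((i div d ^ k) mod d)) = (\<Prod>k<n. \<Sum>a<d. f k a)"
proof (induction n arbitrary: f)
  case 0
  then show ?case by simp
next
  case (Suc n)
  have "(\<Sum>i<d ^ Suc n. \<Prod>k<Suc n. f k ((i div d ^ k) mod d))
    = (\<Sum>j<d ^ n. \<Sum>i\<in>{j*d..<j*d+d}. \<Prod>k<Suc n. f k ((i div d ^ k) mod d))"
    by (subst sum.nat_group) (simp add: mult.commute)
  also have "\<dots> = (\<Sum>j<d ^ n. \<Sum>a<d. f 0 a * (\<Prod>k<n. f (Suc k) ((j div d ^ k) mod d)))"
  proof (rule sum.cong[OF refl])
    fix j
    have "(\<Sum>i\<in>{j*d..<j*d+d}. \<Prod>k<Suc n. f k ((i div d ^ k) mod d))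
      = (\<Sum>a<d. \<Prod>k<Suc n. f k (((a + j * d) div d ^ k) mod d))"
      using sum.shift_bounds_nat_ivl[of "\<lambda>i. \<Prod>k<Suc n. f k ((i div d ^ k) mod d)" 0 "j*d" d]
      by (simp add: atLeast0LessThan add.commute del: prod.lessThan_Suc)
    also have "\<dots> = (\<Sum>a<d. f 0 a * (\<Prod>k<n. f (Suc k) ((j div d ^ k) mod d)))"
    proof (rule sum.cong[OF refl])
      fix a assume "a \<in> {..<d}"
      then have a: "a < d" by simp
      then show "(\<Prod>k<Suc n. f k (((a + j * d) div d ^ k) mod d)) = f 0 a * (\<Prod>k<n. f (Suc k) ((j div d ^ k) mod d))"
        by (simp add: prod.lessThan_Suc_shift div_mult2_eq del: prod.lessThan_Suc)
    qed
    finally show "(\<Sum>i\<in>{j*d..<j*d+d}. \<Prod>k<Suc n. f k ((i div d ^ k) mod d))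
      = (\<Sum>a<d. f 0 a * (\<Prod>k<n. f (Suc k) ((j div d ^ k) mod d)))" .
  qed
  also have "\<dots> = (\<Sum>a<d. f 0 a) * (\<Sum>j<d ^ n. \<Prod>k<n. f (Suc k) ((j div d ^ k) mod d))"
    by (simp add: sum_distrib_left sum_distrib_right)
  also have "\<dots> = (\<Prod>k<Suc n. \<Sum>a<d. f k a)"
    by (simp add: Suc.IH[of "\<lambda>k. f (Suc k)"] prod.lessThan_Suc_shift del: prod.lessThan_Suc)
  finally show ?case .
qed

lemma sum_prod_digits2:
  fixes f :: "nat \<Rightarrow> nat \<Rightarrow> 'a::comm_semiring_1"
  shows "(\<Sum>i<d ^ n. \<Sum>j<d ^ n. \<Prod>k<n. f ((i div d ^ k) mod d) ((j div d ^ k) mod d))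
    = (\<Sum>a<d. \<Sum>b<d. f a b) ^ n"
proof -
  have "(\<Sum>j<d ^ n. \<Prod>k<n. f ((i div d ^ k) mod d) ((j div d ^ k) mod d))
    = (\<Prod>k<n. \<Sum>b<d. f ((i div d ^ k) mod d) b)" for i
    by (rule sum_prod_digits[where f = "\<lambda>k. f ((i div d ^ k) mod d)"])
  then show ?thesis
    using sum_prod_digits[where f = "\<lambda>_ a. \<Sum>b<d. f a b"] by simp
qed

lemma tensor_pow_carrier: "tensor_pow d n \<rho> \<in> carrier_mat (d ^ n) (d ^ n)"
  by (simp add: tensor_pow_def)

lemma mtrace_tensor_pow: "\<rho> \<in> carrier_mat d d \<Longrightarrow> mtrace (tensor_pow d n \<rho>) = mtrace \<rho> ^ n"
  using sum_prod_digits[where f = "\<lambda>_ a. \<rho> $$ (a,a)" and n = n and d = d] by (simp add: mtrace_def tensor_pow_def)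

text \<open>Estimation yields a test: \<open>F\<close> collects the outcomes whose estimate is
  within \<epsilon> of \<open>h\<close>. As \<open>h\<close> exceeds \<open>2 * \<epsilon>\<close>,
  none of them is within \<epsilon> of \<open>0\<close>, the value at \<sigma>, so \<open>F\<close>
  fires on \<sigma> with probability at most \<open>1/3\<close>.\<close>

lemma hellinger_estimator_test:
  assumes est: "hellinger_estimator d \<sigma> r \<epsilon> n m E est"
    and \<sigma>: "density d \<sigma>" "crank \<sigma> \<le> r" "hellinger \<sigma> \<sigma> = 0"
    and pos: "\<And>A. psd (d ^ n) A \<Longrightarrow> 0 \<le> Re (mtrace (A * tensor_pow d n \<sigma>))"
    and h: "2 * \<epsilon> < h"
  obtains F where "psd (d ^ n) F" "\<And>x. Re (qform (d ^ n) F x) \<le> (\<Sum>i<d ^ n. (cmod (x i))\<^sup>2)"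
    "Re (mtrace (F * tensor_pow d n \<sigma>)) \<le> 1/3"
    "\<And>\<rho>. density d \<rho> \<Longrightarrow> crank \<rho> \<le> r \<Longrightarrow> hellinger \<rho> \<sigma> = h \<Longrightarrow> Re (mtrace (F * tensor_pow d n \<rho>)) \<ge> 2/3"
proof -
  let ?D = "d ^ n"
  let ?T = "tensor_pow d n"
  define S where "S h = {k. k < m \<and> \<bar>est k - h\<bar> \<le> \<epsilon>}" for h :: real
  have fin: "finite (S h)" for h by (simp add: S_def)
  have sub: "S h \<subseteq> {..<m}" for h by (auto simp: S_def)
  define F where "F = mat ?D ?D (\<lambda>(i,j). \<Sum>k\<in>S h. E k $$ (i,j))"
  have E: "psd ?D (E k)" if "k < m" for k
    using est that by (simp add: hellinger_estimator_def povm_def)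
  have Esum: "(\<Sum>k<m. E k $$ (i,j)) = of_bool (i = j)" if "i < ?D" "j < ?D" for i j
    using est that by (simp add: hellinger_estimator_def povm_def)
  have tr: "mtrace (F * ?T \<rho>) = (\<Sum>k\<in>S h. mtrace (E k * ?T \<rho>))" for \<rho>
  proof -
    have "mtrace (F * ?T \<rho>) = (\<Sum>i<?D. \<Sum>j<?D. \<Sum>k\<in>S h. E k $$ (i,j) * ?T \<rho> $$ (j,i))"
      by (subst mtrace_mult[of _ ?D]) (auto simp: F_def tensor_pow_carrier sum_distrib_right)
    also have "\<dots> = (\<Sum>i<?D. \<Sum>k\<in>S h. \<Sum>j<?D. E k $$ (i,j) * ?T \<rho> $$ (j,i))"
      by (intro sum.cong refl sum.swap)
    also have "\<dots> = (\<Sum>k\<in>S h. \<Sum>i<?D. \<Sum>j<?D. E k $$ (i,j) * ?T \<rho> $$ (j,i))"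
      by (rule sum.swap)
    also have "\<dots> = (\<Sum>k\<in>S h. mtrace (E k * ?T \<rho>))"
      by (intro sum.cong refl mtrace_mult[symmetric] tensor_pow_carrier psd_carrier[OF E])
        (use sub in auto)
    finally show ?thesis .
  qed
  have succ: "(\<Sum>k\<in>S (hellinger \<rho> \<sigma>). Re (mtrace (E k * ?T \<rho>))) \<ge> 2/3"
    if "density d \<rho>" "crank \<rho> \<le> r" for \<rho>
    using est that by (simp add: hellinger_estimator_def S_def)
  have qF: "Re (qform ?D F x) = (\<Sum>k\<in>S h. Re (qform ?D (E k) x))" for x
  proof -
    have "qform ?D F x = (\<Sum>i<?D. \<Sum>j<?D. \<Sum>k\<in>S h. cnj (x i) * E k $$ (i,j) * x j)"
      by (simp add: qform_def F_def sum_distrib_left sum_distrib_right)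
    also have "\<dots> = (\<Sum>i<?D. \<Sum>k\<in>S h. \<Sum>j<?D. cnj (x i) * E k $$ (i,j) * x j)"
      by (intro sum.cong refl sum.swap)
    also have "\<dots> = (\<Sum>k\<in>S h. qform ?D (E k) x)"
      unfolding qform_def by (rule sum.swap)
    finally show ?thesis by simp
  qed
  \<comment> \<open>Completeness of the POVM; dropping the outcomes outside \<open>S h\<close> then
    gives \<open>F \<le> I\<close>.\<close>
  have qtot: "(\<Sum>k<m. Re (qform ?D (E k) x)) = (\<Sum>i<?D. (cmod (x i))\<^sup>2)" for x
  proof -
    have "(\<Sum>k<m. qform ?D (E k) x) = (\<Sum>i<?D. \<Sum>k<m. \<Sum>j<?D. cnj (x i) * E k $$ (i,j) * x j)"
      unfolding qform_def by (rule sum.swap)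
    also have "\<dots> = (\<Sum>i<?D. \<Sum>j<?D. \<Sum>k<m. cnj (x i) * E k $$ (i,j) * x j)"
      by (intro sum.cong refl sum.swap)
    also have "\<dots> = (\<Sum>i<?D. \<Sum>j<?D. cnj (x i) * of_bool (i = j) * x j)"
      by (intro sum.cong refl) (simp add: Esum[symmetric] sum_distrib_left sum_distrib_right)
    also have "\<dots> = (\<Sum>i<?D. of_real ((cmod (x i))\<^sup>2))"
    proof (intro sum.cong refl)
      fix i assume "i \<in> {..<?D}"
      moreover have "(\<Sum>j<?D. cnj (x i) * of_bool (i = j) * x j) = (\<Sum>j<?D. if i = j then cnj (x i) * x j else 0)"
        by (intro sum.cong) auto
      ultimately show "(\<Sum>j<?D. cnj (x i) * of_bool (i = j) * x j) = of_real ((cmod (x i))\<^sup>2)"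
        by (simp add: complex_norm_square mult.commute del: of_real_power)
    qed
    finally have "Re (\<Sum>k<m. qform ?D (E k) x) = Re (\<Sum>i<?D. of_real ((cmod (x i))\<^sup>2))" by simp
    then show ?thesis by simp
  qed
  have trtot: "(\<Sum>k<m. mtrace (E k * ?T \<sigma>)) = 1"
  proof -
    have "(\<Sum>k<m. mtrace (E k * ?T \<sigma>)) = (\<Sum>k<m. \<Sum>i<?D. \<Sum>j<?D. E k $$ (i,j) * ?T \<sigma> $$ (j,i))"
      by (intro sum.cong refl mtrace_mult tensor_pow_carrier psd_carrier[OF E]) auto
    also have "\<dots> = (\<Sum>i<?D. \<Sum>k<m. \<Sum>j<?D. E k $$ (i,j) * ?T \<sigma> $$ (j,i))"
      by (rule sum.swap)
    also have "\<dots> = (\<Sum>i<?D. \<Sum>j<?D. \<Sum>k<m. E k $$ (i,j) * ?T \<sigma> $$ (j,i))"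
      by (intro sum.cong refl sum.swap)
    also have "\<dots> = (\<Sum>i<?D. \<Sum>j<?D. of_bool (i = j) * ?T \<sigma> $$ (j,i))"
      by (intro sum.cong refl) (simp add: Esum[symmetric] sum_distrib_right)
    also have "\<dots> = mtrace (?T \<sigma>)"
      using tensor_pow_carrier[of d n \<sigma>]
      by (simp add: mtrace_def of_bool_def if_distrib[of "\<lambda>c. c * _"] cong: if_cong)
    also have "\<dots> = 1"
      using \<sigma>(1) by (simp add: mtrace_tensor_pow density_def psd_carrier)
    finally show ?thesis .
  qed
  show ?thesis
  proof
    have "cnj (F $$ (i,j)) = F $$ (j,i)" if "i < ?D" "j < ?D" for i j
    proof -
      have "cnj (E k $$ (i,j)) = E k $$ (j,i)" if "k \<in> S h" for k
        using that \<open>i < ?D\<close> \<open>j < ?D\<close> sub psd_hermitian[OF E] by blast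
      then show ?thesis using that by (simp add: F_def)
    qed
    moreover have "0 \<le> Re (qform ?D F x)" for x
      unfolding qF using sub by (intro sum_nonneg psd_qform_nonneg E) auto
    ultimately show "psd ?D F" by (auto simp: psd_iff F_def)
    show "Re (qform ?D F x) \<le> (\<Sum>i<?D. (cmod (x i))\<^sup>2)" for x
      unfolding qF qtot[symmetric] using sub
      by (intro sum_mono2) (auto intro!: psd_qform_nonneg E)
    have disj: "S 0 \<inter> S h = {}" using h by (auto simp: S_def)
    have "(\<Sum>k\<in>S 0. Re (mtrace (E k * ?T \<sigma>))) + (\<Sum>k\<in>S h. Re (mtrace (E k * ?T \<sigma>)))
       = (\<Sum>k\<in>S 0 \<union> S h. Re (mtrace (E k * ?T \<sigma>)))"
      by (rule sum.union_disjoint[symmetric]) (use fin disj in auto)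
    also have "\<dots> \<le> (\<Sum>k<m. Re (mtrace (E k * ?T \<sigma>)))"
      using sub by (intro sum_mono2) (auto intro!: pos E)
    also have "\<dots> = 1" using trtot by (metis Re_sum one_complex.sel(1))
    finally show "Re (mtrace (F * ?T \<sigma>)) \<le> 1/3"
      using succ[OF \<sigma>(1,2)] \<sigma>(3) by (simp add: tr)
    show "Re (mtrace (F * ?T \<rho>)) \<ge> 2/3" if "density d \<rho>" "crank \<rho> \<le> r" "hellinger \<rho> \<sigma> = h" for \<rho>
      using succ[OF that(1,2)] that(3) by (simp add: tr)
  qed
qed

text \<open>Ingster's second moment method: the conclusion says that the \<open>\<chi>\<^sup>2\<close>-divergence of the average
  of the \<open>T \<pi>\<close> from \<open>I/D\<close> is at least \<open>1/3\<close>.\<close>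

lemma mixture_second_moment:
  fixes T :: "'a \<Rightarrow> nat \<Rightarrow> nat \<Rightarrow> real"
  assumes D: "D > 0" and P: "finite P" "P \<noteq> {}"
    and F: "psd D F" "\<And>x. Re (qform D F x) \<le> (\<Sum>i<D. (cmod (x i))\<^sup>2)"
    and null: "Re (mtrace F) / D \<le> 1/3"
    and alt: "\<And>\<pi>. \<pi> \<in> P \<Longrightarrow> (\<Sum>i<D. \<Sum>j<D. Re (F $$ (i,j)) * T \<pi> i j) \<ge> 2/3"
    and tr: "\<And>\<pi>. \<pi> \<in> P \<Longrightarrow> (\<Sum>i<D. T \<pi> i i) = 1"
  shows "4/3 * (real (card P))\<^sup>2 \<le> (\<Sum>\<pi>\<in>P. \<Sum>\<pi>'\<in>P. D * (\<Sum>i<D. \<Sum>j<D. T \<pi> i j * T \<pi>' i j))"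
proof -
  define N where "N = real (card P)"
  have N: "N > 0" using P by (simp add: N_def card_gt_0_iff)
  define M where "M i j = (\<Sum>\<pi>\<in>P. T \<pi> i j) / N" for i j
  define \<phi> where "\<phi> = Re (mtrace F) / D"
  have avg: "(\<Sum>i<D. \<Sum>j<D. c i j * M i j) = (\<Sum>\<pi>\<in>P. \<Sum>i<D. \<Sum>j<D. c i j * T \<pi> i j) / N" for c
  proof -
    have "(\<Sum>i<D. \<Sum>j<D. c i j * M i j) = (\<Sum>i<D. \<Sum>j<D. \<Sum>\<pi>\<in>P. c i j * T \<pi> i j) / N"
      by (simp add: M_def sum_distrib_left sum_divide_distrib)
    also have "(\<Sum>i<D. \<Sum>j<D. \<Sum>\<pi>\<in>P. c i j * T \<pi> i j) = (\<Sum>i<D. \<Sum>\<pi>\<in>P. \<Sum>j<D. c i j * T \<pi> i j)"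
      by (intro sum.cong refl sum.swap)
    also have "\<dots> = (\<Sum>\<pi>\<in>P. \<Sum>i<D. \<Sum>j<D. c i j * T \<pi> i j)"
      by (rule sum.swap)
    finally show ?thesis .
  qed
  \<comment> \<open>Used as a literal rewrite pattern, which is why some sums below carry an
    explicit factor \<open>1\<close>.\<close>
  have dg: "(\<Sum>i<D. \<Sum>j<D. c i * of_bool (i = j) * a i j) = (\<Sum>i<D. c i * a i i)" for c :: "nat \<Rightarrow> real" and a
  proof (rule sum.cong[OF refl])
    fix i assume "i \<in> {..<D}"
    moreover have "(\<Sum>j<D. c i * of_bool (i = j) * a i j) = (\<Sum>j<D. if i = j then c i * a i j else 0)"
      by (intro sum.cong) auto
    ultimately show "(\<Sum>j<D. c i * of_bool (i = j) * a i j) = c i * a i i" by simp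
  qed
  define Q where "Q = (\<Sum>i<D. \<Sum>j<D. (M i j)\<^sup>2)"
  have FM: "(\<Sum>i<D. \<Sum>j<D. Re (F $$ (i,j)) * M i j) \<ge> 2/3"
  proof -
    have "(\<Sum>\<pi>\<in>P. 2/3) \<le> (\<Sum>\<pi>\<in>P. \<Sum>i<D. \<Sum>j<D. Re (F $$ (i,j)) * T \<pi> i j)"
      by (rule sum_mono[OF alt])
    then show ?thesis unfolding avg using N by (simp add: N_def field_simps)
  qed
  have MI: "(\<Sum>i<D. M i i) = 1"
  proof -
    have "(\<Sum>i<D. \<Sum>j<D. 1 * of_bool (i = j) * M i j) = 1"
      unfolding avg dg using tr N by (simp add: N_def)
    then show ?thesis unfolding dg by simp
  qed
  have FI: "(\<Sum>i<D. Re (F $$ (i,i))) = D * \<phi>"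
    using D psd_carrier[OF F(1)] by (simp add: \<phi>_def mtrace_def)
  have FF: "(\<Sum>i<D. \<Sum>j<D. (Re (F $$ (i,j)))\<^sup>2) \<le> D * \<phi>"
  proof -
    have "(\<Sum>i<D. \<Sum>j<D. (Re (F $$ (i,j)))\<^sup>2) \<le> (\<Sum>i<D. \<Sum>j<D. (cmod (F $$ (i,j)))\<^sup>2)"
      by (intro sum_mono) (simp add: cmod_def)
    also have "\<dots> \<le> D * \<phi>" using psd_trace_square_le[OF F] D by (simp add: \<phi>_def)
    finally show ?thesis .
  qed
  \<comment> \<open>AM-GM: \<open>2 F (M - I/D) \<le> F\<^sup>2/D + D (M - I/D)\<^sup>2\<close>, summed over the entries\<close>
  have "2 * (Re (F $$ (i,j)) * M i j) - 2 / D * of_bool (i = j) * Re (F $$ (i,j))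
      \<le> (Re (F $$ (i,j)))\<^sup>2 / D + D * (M i j)\<^sup>2 - 2 * of_bool (i = j) * M i j + 1 / D * of_bool (i = j) * 1" for i j
  proof -
    define f m b where fmb: "f = Re (F $$ (i,j))" "m = M i j" "b = (of_bool (i = j) :: real)"
    have b: "b * b = b" by (simp add: fmb)
    have "0 \<le> (f - D * m + b)\<^sup>2 / D" by simp
    also have "\<dots> = f\<^sup>2 / D + D * m\<^sup>2 + (b * b) / D - 2 * (f * m) + 2 / D * b * f - 2 * b * m"
      using D by (simp add: field_simps power2_eq_square)
    finally show ?thesis unfolding fmb(1,2)[symmetric] fmb(3)[symmetric] b by simp
  qed
  then have "(\<Sum>i<D. \<Sum>j<D. 2 * (Re (F $$ (i,j)) * M i j) - 2 / D * of_bool (i = j) * Re (F $$ (i,j)))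
      \<le> (\<Sum>i<D. \<Sum>j<D. (Re (F $$ (i,j)))\<^sup>2 / D + D * (M i j)\<^sup>2 - 2 * of_bool (i = j) * M i j + 1 / D * of_bool (i = j) * 1)"
    by (intro sum_mono)
  then have "2 * (\<Sum>i<D. \<Sum>j<D. Re (F $$ (i,j)) * M i j) - 2 / D * (\<Sum>i<D. Re (F $$ (i,i)))
      \<le> (\<Sum>i<D. \<Sum>j<D. (Re (F $$ (i,j)))\<^sup>2) / D + D * Q - 2 * (\<Sum>i<D. M i i) + (\<Sum>i<D. 1 / D * 1)"
    unfolding sum.distrib sum_subtractf dg Q_def sum_distrib_left sum_divide_distrib .
  moreover have "(\<Sum>i<D. \<Sum>j<D. (Re (F $$ (i,j)))\<^sup>2) / D \<le> \<phi>"
    using FF D by (simp add: field_simps)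
  moreover have "2 / D * (\<Sum>i<D. Re (F $$ (i,i))) = 2 * \<phi>" "(\<Sum>i<D. 1 / D * 1 :: real) = 1"
    using D by (simp_all add: FI)
  \<comment> \<open>The summed inequality has become
    \<open>2 * (2/3) - 2 * \<phi> \<le> \<phi> + D * Q - 1\<close>, and
    \<open>\<phi> \<le> 1/3\<close>.\<close>
  ultimately have "4/3 \<le> D * Q" using FM MI null unfolding \<phi>_def[symmetric] by linarith
  moreover have "N\<^sup>2 * Q = (\<Sum>\<pi>\<in>P. \<Sum>\<pi>'\<in>P. \<Sum>i<D. \<Sum>j<D. T \<pi> i j * T \<pi>' i j)"
  proof -
    have "N\<^sup>2 * Q = N * (N * (\<Sum>i<D. \<Sum>j<D. M i j * M i j))" by (simp add: Q_def power2_eq_square)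
    also have "\<dots> = N * (\<Sum>\<pi>\<in>P. \<Sum>i<D. \<Sum>j<D. T \<pi> i j * M i j)"
      using avg[of M] N by (simp add: mult.commute)
    also have "\<dots> = (\<Sum>\<pi>\<in>P. \<Sum>\<pi>'\<in>P. \<Sum>i<D. \<Sum>j<D. T \<pi> i j * T \<pi>' i j)"
      unfolding sum_distrib_left[of N _ P]
    proof (rule sum.cong[OF refl])
      fix \<pi>
      show "N * (\<Sum>i<D. \<Sum>j<D. T \<pi> i j * M i j) = (\<Sum>\<pi>'\<in>P. \<Sum>i<D. \<Sum>j<D. T \<pi> i j * T \<pi>' i j)"
        using avg[of "T \<pi>"] N by simp
    qed
    finally show ?thesis .
  qed
  ultimately have "4/3 * N\<^sup>2 \<le> D * (\<Sum>\<pi>\<in>P. \<Sum>\<pi>'\<in>P. \<Sum>i<D. \<Sum>j<D. T \<pi> i j * T \<pi>' i j)"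
    using mult_right_mono[of "4/3" "D * Q" "N\<^sup>2"] by (metis mult.assoc mult.commute zero_le_power2)
  then show ?thesis by (simp add: N_def sum_distrib_left)
qed

lemma digits_eqD:
  fixes i j :: nat
  assumes "\<And>k. k < n \<Longrightarrow> (i div d ^ k) mod d = (j div d ^ k) mod d"
  shows "i mod d ^ n = j mod d ^ n"
  using assms
proof (induction n)
  case (Suc n)
  then show ?case by (simp add: mod_mult2_eq mult.commute[of d])
qed simp

lemma tensor_pow_scalar:
  assumes "i < d ^ n" "j < d ^ n"
  shows "tensor_pow d n (c \<cdot>\<^sub>m 1\<^sub>m d) $$ (i,j) = c ^ n * of_bool (i = j)"
\<comment> \<open>For \<open>d = 0\<close> digits are not bounded by \<open>d\<close>, but then
  indices exist only for \<open>n = 0\<close>.\<close>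
proof (cases "d = 0")
  case True
  then show ?thesis using assms by (cases n) (auto simp: tensor_pow_def)
next
  case False
  then have "tensor_pow d n (c \<cdot>\<^sub>m 1\<^sub>m d) $$ (i,j)
    = (\<Prod>k<n. c * of_bool ((i div d ^ k) mod d = (j div d ^ k) mod d))"
    using assms by (auto simp: tensor_pow_def of_bool_def intro!: prod.cong)
  also have "\<dots> = c ^ n * of_bool (i = j)"
  proof (cases "i = j")
    case False
    then obtain k where "k < n" "(i div d ^ k) mod d \<noteq> (j div d ^ k) mod d"
      using digits_eqD[of n i d j] assms by (metis mod_less)
    then have "(\<Prod>k<n. c * of_bool ((i div d ^ k) mod d = (j div d ^ k) mod d)) = 0"
      by (intro prod_zero) auto
    then show ?thesis using False by simp
  qed simp
  finally show ?thesis .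
qed

lemma mtrace_mult_tensor_pow_scalar:
  assumes "A \<in> carrier_mat (d ^ n) (d ^ n)"
  shows "mtrace (A * tensor_pow d n (c \<cdot>\<^sub>m 1\<^sub>m d)) = c ^ n * mtrace A"
proof -
  have "mtrace (A * tensor_pow d n (c \<cdot>\<^sub>m 1\<^sub>m d))
    = (\<Sum>i<d ^ n. \<Sum>j<d ^ n. if j = i then c ^ n * A $$ (i,j) else 0)"
    unfolding mtrace_mult[OF assms tensor_pow_carrier]
    by (intro sum.cong refl) (auto simp: tensor_pow_scalar)
  then show ?thesis using assms by (simp add: mtrace_def sum_distrib_left)
qed

section \<open>States perturbed along a matching\<close>

text \<open>These are the fixed-point-free involutions of \<open>{..<q}\<close>, that is, its
  perfect matchings.\<close>

definition pairing :: "nat \<Rightarrow> (nat \<Rightarrow> nat) \<Rightarrow> bool" where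
  "pairing q g \<longleftrightarrow> (\<forall>i<q. g i < q \<and> g (g i) = i \<and> g i \<noteq> i)"

lemma pairingD:
  assumes "pairing q g" "i < q"
  shows "g i < q" "g (g i) = i" "g i \<noteq> i" "i \<noteq> g i"
  using assms unfolding pairing_def by metis+

text \<open>The matrix \<open>(u + w)/2 \<cdot> I + (u - w)/2 \<cdot> X\<close> on the first \<open>q\<close> coordinates, where \<open>X\<close> is the permutation
  matrix of the pairing \<open>g\<close>, and \<open>z \<cdot> I\<close> on the others. Its eigenvalues are \<open>u\<close>, \<open>w\<close>, \<open>z\<close>, with
  eigenspaces that depend only on \<open>g\<close>; hence products and square roots act on \<open>(u, w, z)\<close>
  componentwise.\<close>

definition pairing_entry :: "nat \<Rightarrow> (nat \<Rightarrow> nat) \<Rightarrow> real \<Rightarrow> real \<Rightarrow> real \<Rightarrow> nat \<Rightarrow> nat \<Rightarrow> real" where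
  "pairing_entry q g u w z i j =
    (if i < q then (u + w) / 2 * of_bool (i = j) + (u - w) / 2 * of_bool (j = g i) else z * of_bool (i = j))"

definition pairing_mat :: "nat \<Rightarrow> nat \<Rightarrow> (nat \<Rightarrow> nat) \<Rightarrow> real \<Rightarrow> real \<Rightarrow> real \<Rightarrow> complex mat" where
  "pairing_mat d q g u w z = mat d d (\<lambda>(i,j). of_real (pairing_entry q g u w z i j))"

lemma pairing_mat_carrier: "pairing_mat d q g u w z \<in> carrier_mat d d"
  by (simp add: pairing_mat_def)

lemma pairing_mat_index:
  "i < d \<Longrightarrow> j < d \<Longrightarrow> pairing_mat d q g u w z $$ (i,j) = of_real (pairing_entry q g u w z i j)"
  by (simp add: pairing_mat_def)

text \<open>A row has at most two nonzero entries, at \<open>i\<close> and \<open>g i\<close>. Both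
  products and inner products of these matrices reduce to this.\<close>

lemma pairing_entry_sum:
  assumes g: "pairing q g" and q: "q \<le> d" and i: "i < d"
  shows "(\<Sum>k<d. pairing_entry q g u w z i k * f k) =
    (if i < q then (u + w) / 2 * f i + (u - w) / 2 * f (g i) else z * f i)"
proof -
  have delta: "(\<Sum>k<d. c * of_bool (k = a) * f k) = c * f a" if "a < d" for a c
  proof -
    have "(\<Sum>k<d. c * of_bool (k = a) * f k) = (\<Sum>k<d. if k = a then c * f k else 0)"
      by (intro sum.cong) auto
    then show ?thesis using that by simp
  qed
  have delta': "(\<Sum>k<d. c * of_bool (i = k) * f k) = c * f i" for c
  proof -
    have "(\<Sum>k<d. c * of_bool (i = k) * f k) = (\<Sum>k<d. if k = i then c * f k else 0)"
      by (intro sum.cong) auto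
    then show ?thesis using i by simp
  qed
  show ?thesis
  proof (cases "i < q")
    case True
    then have "g i < d" using pairingD(1)[OF g] q by (blast intro: less_le_trans)
    then show ?thesis
      using True by (simp only: pairing_entry_def if_True distrib_right sum.distrib delta delta')
  next
    case False
    then show ?thesis
      by (simp only: pairing_entry_def if_False delta')
  qed
qed

text \<open>Since \<open>g\<close> is an involution, \<open>j = g i\<close> is a symmetric relation
  below \<open>q\<close>.\<close>

lemma pairing_entry_sym:
  assumes "pairing q g"
  shows "pairing_entry q g u w z i j = pairing_entry q g u w z j i"
proof -
  have "j < q \<and> i = g j" if "i < q" "j = g i" for i j
    using pairingD[OF assms that(1)] that(2) by simp
  then have "(i < q \<and> j = g i) = (j < q \<and> i = g j)" by blast
  then show ?thesis unfolding pairing_entry_def by (cases "i = j") auto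
qed

lemma pairing_mat_hermitian:
  assumes "pairing q g" "i < d" "j < d"
  shows "cnj (pairing_mat d q g u w z $$ (i,j)) = pairing_mat d q g u w z $$ (j,i)"
  using pairing_entry_sym[OF assms(1)] assms(2,3) by (simp add: pairing_mat_index)

lemma pairing_mat_mult:
  assumes g: "pairing q g" and q: "q \<le> d"
  shows "pairing_mat d q g u w z * pairing_mat d q g u' w' z' = pairing_mat d q g (u * u') (w * w') (z * z')"
proof (rule eq_matI)
  fix i j assume "i < dim_row (pairing_mat d q g (u * u') (w * w') (z * z'))"
    and "j < dim_col (pairing_mat d q g (u * u') (w * w') (z * z'))"
  then have ij: "i < d" "j < d" by (auto simp: pairing_mat_def)
  have "(\<Sum>k<d. pairing_entry q g u w z i k * pairing_entry q g u' w' z' k j)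
      = pairing_entry q g (u * u') (w * w') (z * z') i j"
  proof (subst pairing_entry_sum[OF g q ij(1)], cases "i < q")
    case True
    then have gi: "g i < q" "g (g i) = i" "g i \<noteq> i" using pairingD[OF g] by blast+
    show "(if i < q then (u + w) / 2 * pairing_entry q g u' w' z' i j
        + (u - w) / 2 * pairing_entry q g u' w' z' (g i) j else z * pairing_entry q g u' w' z' i j)
      = pairing_entry q g (u * u') (w * w') (z * z') i j"
      using True gi by (auto simp: pairing_entry_def of_bool_def field_simps)
  qed (simp add: pairing_entry_def)
  then show "(pairing_mat d q g u w z * pairing_mat d q g u' w' z') $$ (i,j)
      = pairing_mat d q g (u * u') (w * w') (z * z') $$ (i,j)"
    unfolding mult_mat_index[OF pairing_mat_carrier pairing_mat_carrier ij] pairing_mat_index[OF ij]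
    by (simp add: pairing_mat_index ij flip: of_real_mult of_real_sum)
qed (auto simp: pairing_mat_def)

lemma pairing_mat_sqrt_square:
  assumes "pairing q g" "q \<le> d" "u \<ge> 0" "w \<ge> 0" "z \<ge> 0"
  shows "pairing_mat d q g (sqrt u) (sqrt w) (sqrt z) * pairing_mat d q g (sqrt u) (sqrt w) (sqrt z)
    = pairing_mat d q g u w z"
  using assms by (simp add: pairing_mat_mult)

text \<open>The square root lies in the same family, so the matrix is the square of a Hermitian
  one.\<close>

lemma psd_pairing_mat:
  assumes "pairing q g" "q \<le> d" "u \<ge> 0" "w \<ge> 0" "z \<ge> 0"
  shows "psd d (pairing_mat d q g u w z)"
  by (subst pairing_mat_sqrt_square[OF assms, symmetric])
    (intro psd_square pairing_mat_carrier pairing_mat_hermitian[OF assms(1)])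

lemma msqrt_pairing_mat:
  assumes "pairing q g" "q \<le> d" "u \<ge> 0" "w \<ge> 0" "z \<ge> 0"
  shows "msqrt (pairing_mat d q g u w z) = pairing_mat d q g (sqrt u) (sqrt w) (sqrt z)"
  using assms by (intro msqrt_eqI[of d] psd_pairing_mat pairing_mat_sqrt_square) auto

lemma sum_if_less:
  fixes a b :: real
  assumes "q \<le> d"
  shows "(\<Sum>i<d. if i < q then a else b) = real q * a + (real d - real q) * b"
proof -
  have "{..<d} \<inter> {i. i < q} = {..<q}" "{..<d} \<inter> - {i. i < q} = {q..<d}" using assms by auto
  then show ?thesis using assms by (simp add: sum.If_cases of_nat_diff)
qed

lemma mtrace_pairing_mat:
  assumes "pairing q g" "q \<le> d"
  shows "mtrace (pairing_mat d q g u w z) = of_real (real q * ((u + w) / 2) + (real d - real q) * z)"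
proof -
  have "pairing_entry q g u w z i i = (if i < q then (u + w) / 2 else z)" for i
    using pairingD(4)[OF assms(1), of i] by (auto simp: pairing_entry_def)
  moreover have "mtrace (pairing_mat d q g u w z) = of_real (\<Sum>i<d. pairing_entry q g u w z i i)"
    by (simp add: mtrace_def pairing_mat_def)
  ultimately show ?thesis by (simp only: sum_if_less[OF assms(2)])
qed

text \<open>Without fixed points, diagonal and matching entries never meet; matching entries meet
  exactly in the rows where \<open>g\<close> and \<open>g'\<close> agree.\<close>

lemma pairing_entry_inner:
  assumes g: "pairing q g" and g': "pairing q g'" and q: "q \<le> d"
  shows "(\<Sum>i<d. \<Sum>j<d. pairing_entry q g u w z i j * pairing_entry q g' u w z i j) =
    real q * ((u + w) / 2)\<^sup>2 + ((u - w) / 2)\<^sup>2 * real (card {i. i < q \<and> g i = g' i}) + (real d - real q) * z\<^sup>2"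
proof -
  have "(\<Sum>j<d. pairing_entry q g u w z i j * pairing_entry q g' u w z i j)
    = (if i < q then ((u + w) / 2)\<^sup>2 else z\<^sup>2) + (if i \<in> {i. i < q \<and> g i = g' i} then ((u - w) / 2)\<^sup>2 else 0)"
    if i: "i < d" for i
  proof -
    have "g i \<noteq> i \<and> g' i \<noteq> i" if "i < q" using pairingD(3)[OF g] pairingD(3)[OF g'] that by blast
    then show ?thesis
      by (subst pairing_entry_sum[OF g q i]) (auto simp: pairing_entry_def power2_eq_square)
  qed
  then have "(\<Sum>i<d. \<Sum>j<d. pairing_entry q g u w z i j * pairing_entry q g' u w z i j) =
    (\<Sum>i<d. if i < q then ((u + w) / 2)\<^sup>2 else z\<^sup>2) +
    (\<Sum>i<d. if i \<in> {i. i < q \<and> g i = g' i} then ((u - w) / 2)\<^sup>2 else 0)"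
    by (simp add: sum.distrib)
  moreover have "(\<Sum>i<d. if i \<in> {i. i < q \<and> g i = g' i} then ((u - w) / 2)\<^sup>2 else 0)
    = ((u - w) / 2)\<^sup>2 * real (card {i. i < q \<and> g i = g' i})"
  proof -
    have "{..<d} \<inter> {i. i < q \<and> g i = g' i} = {i. i < q \<and> g i = g' i}" using q by auto
    then show ?thesis by (subst sum.inter_restrict[symmetric]) auto
  qed
  ultimately show ?thesis unfolding sum_if_less[OF q] by simp
qed

section \<open>Bipartite matchings from permutations\<close>

definition matching :: "nat \<Rightarrow> (nat \<Rightarrow> nat) \<Rightarrow> nat \<Rightarrow> nat" where
  "matching p \<pi> i = (if i < p then p + \<pi> i else inv_into UNIV \<pi> (i - p))"

lemma pairing_matching:
  assumes "\<pi> permutes {..<p}"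
  shows "pairing (2 * p) (matching p \<pi>)"
proof -
  have "\<pi> i < p" "inv_into UNIV \<pi> i < p" if "i < p" for i
    using permutes_in_image[OF assms, of i] permutes_in_image[OF permutes_inv[OF assms], of i] that by auto
  note bounds = this
  show ?thesis unfolding pairing_def
  proof (intro allI impI conjI)
    fix i assume i: "i < 2 * p"
    consider "i < p" | j where "j < p" "i = p + j" using i by (metis add_less_cancel_left le_add_diff_inverse mult_2 not_less)
    note cases = this
    show "matching p \<pi> i < 2 * p"
      by (rule cases) (use bounds in \<open>auto simp: matching_def mult_2 intro: trans_less_add1\<close>)
    show "matching p \<pi> (matching p \<pi> i) = i"
      by (rule cases) (use bounds permutes_inverses[OF assms] in \<open>auto simp: matching_def\<close>)
    show "matching p \<pi> i \<noteq> i"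
      by (rule cases) (use bounds in \<open>auto simp: matching_def\<close>, metis bounds(2) not_add_less1)
  qed
qed

text \<open>An agreement at \<open>i\<close> in the first block brings one at the partner
  \<open>p + \<pi> i\<close> in the second, and all agreements in the second block arise this
  way.\<close>

lemma card_matching_agree:
  assumes p: "\<pi> permutes {..<p}" and p': "\<pi>' permutes {..<p}"
  shows "card {i. i < 2 * p \<and> matching p \<pi> i = matching p \<pi>' i} = 2 * card {i. i < p \<and> \<pi> i = \<pi>' i}"
proof -
  let ?A = "{i. i < p \<and> \<pi> i = \<pi>' i}"
  have im: "\<pi> i < p" if "i < p" for i
    using permutes_in_image[OF p, of i] that by auto
  have im': "inv_into UNIV \<pi> i < p" if "i < p" for i
    using permutes_in_image[OF permutes_inv[OF p], of i] that by auto
  have "{i. i < 2 * p \<and> matching p \<pi> i = matching p \<pi>' i} = ?A \<union> (\<lambda>i. p + \<pi> i) ` ?A"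
  proof (intro equalityI subsetI)
    fix i assume i: "i \<in> {i. i < 2 * p \<and> matching p \<pi> i = matching p \<pi>' i}"
    show "i \<in> ?A \<union> (\<lambda>i. p + \<pi> i) ` ?A"
    proof (cases "i < p")
      case True
      then show ?thesis using i by (auto simp: matching_def)
    next
      case False
      define k where "k = inv_into UNIV \<pi> (i - p)"
      have k: "k = inv_into UNIV \<pi>' (i - p)" using i False by (simp add: k_def matching_def)
      have "k < p" unfolding k_def using i False by (intro im') auto
      moreover have "\<pi> k = i - p" unfolding k_def by (rule permutes_inverses(1)[OF p])
      moreover have "\<pi>' k = i - p" unfolding k by (rule permutes_inverses(1)[OF p'])
      ultimately have "k \<in> ?A" "i = p + \<pi> k" using False by auto
      then show ?thesis by blast
    qed
  next
    fix i assume "i \<in> ?A \<union> (\<lambda>i. p + \<pi> i) ` ?A"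
    then show "i \<in> {i. i < 2 * p \<and> matching p \<pi> i = matching p \<pi>' i}"
    proof
      assume "i \<in> (\<lambda>i. p + \<pi> i) ` ?A"
      then obtain k where k: "k < p" "\<pi> k = \<pi>' k" "i = p + \<pi> k" by auto
      moreover have "inv_into UNIV \<pi> (\<pi> k) = k" using permutes_inverses[OF p] by simp
      moreover have "inv_into UNIV \<pi>' (\<pi> k) = k" using permutes_inverses[OF p'] k(2) by simp
      ultimately show ?thesis using im[of k] by (auto simp: matching_def)
    qed (auto simp: matching_def)
  qed
  moreover have "?A \<inter> (\<lambda>i. p + \<pi> i) ` ?A = {}" by auto
  moreover have "card ((\<lambda>i. p + \<pi> i) ` ?A) = card ?A"
    using permutes_inj[OF p] by (intro card_image) (auto simp: inj_on_def)
  ultimately show ?thesis by (simp add: card_Un_disjoint)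
qed

section \<open>Agreements of two random permutations\<close>

lemma power_card_eq_sum_Pow:
  fixes z :: "'a::comm_semiring_1"
  assumes "finite A"
  shows "(1 + z) ^ card A = (\<Sum>S\<in>Pow A. z ^ card S)"
  using prod_add[OF assms, of "\<lambda>_. z" "\<lambda>_. 1"] by (simp add: add.commute)

lemma exp_ge_partial_sum:
  fixes z :: real
  assumes "z \<ge> 0"
  shows "(\<Sum>k\<le>p. z ^ k / fact k) \<le> exp z"
proof -
  have "(\<Sum>k\<le>p. z ^ k /\<^sub>R fact k) \<le> (\<Sum>k. z ^ k /\<^sub>R fact k)"
    using assms by (intro sum_le_suminf summable_exp_generic) auto
  then show ?thesis by (simp add: exp_def field_simps)
qed

text \<open>The number of fixed points of a random permutation has the factorial moments of a Poisson
  variable of mean \<open>1\<close>, as far as they do not vanish.\<close>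

lemma sum_permutes_fixpoints:
  fixes z :: real
  assumes "z \<ge> 0"
  shows "(\<Sum>\<pi> | \<pi> permutes {..<p}. (1 + z) ^ card {i. i < p \<and> \<pi> i = i}) \<le> fact p * exp z"
proof -
  let ?P = "{\<pi>. \<pi> permutes {..<p}}"
  have finP: "finite ?P" by (simp add: finite_permutations)
  \<comment> \<open>Permutations fixing \<open>S\<close> pointwise are the permutations of its
    complement.\<close>
  have cnt: "(\<Sum>\<pi>\<in>?P. of_bool (\<forall>i\<in>S. \<pi> i = i)) = (fact (p - card S) :: real)" if S: "S \<subseteq> {..<p}" for S
  proof -
    have "?P \<inter> {\<pi>. \<forall>i\<in>S. \<pi> i = i} = {\<pi>. \<pi> permutes ({..<p} - S)}"
      using S by (auto simp: permutes_def)
    moreover have "card {\<pi>. \<pi> permutes ({..<p} - S)} = fact (p - card S)"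
      using S by (intro card_permutations) (auto simp: card_Diff_subset finite_subset)
    ultimately show ?thesis using finP by simp
  qed
  \<comment> \<open>The power is expanded over the subsets of the fixed-point set, so that the two
    sums can be exchanged.\<close>
  have "(\<Sum>\<pi>\<in>?P. (1 + z) ^ card {i. i < p \<and> \<pi> i = i})
    = (\<Sum>\<pi>\<in>?P. \<Sum>S\<in>Pow {..<p}. of_bool (\<forall>i\<in>S. \<pi> i = i) * z ^ card S)"
  proof (rule sum.cong[OF refl])
    fix \<pi>
    have "(\<Sum>S\<in>Pow {..<p}. of_bool (\<forall>i\<in>S. \<pi> i = i) * z ^ card S)
      = (\<Sum>S\<in>Pow {i. i < p \<and> \<pi> i = i}. z ^ card S)"
      by (rule sum.mono_neutral_cong_right) auto
    then show "(1 + z) ^ card {i. i < p \<and> \<pi> i = i}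
      = (\<Sum>S\<in>Pow {..<p}. of_bool (\<forall>i\<in>S. \<pi> i = i) * z ^ card S)"
      by (simp add: power_card_eq_sum_Pow)
  qed
  also have "\<dots> = (\<Sum>S\<in>Pow {..<p}. \<Sum>\<pi>\<in>?P. of_bool (\<forall>i\<in>S. \<pi> i = i) * z ^ card S)"
    by (rule sum.swap)
  also have "\<dots> = (\<Sum>S\<in>Pow {..<p}. fact (p - card S) * z ^ card S)"
    by (intro sum.cong refl) (simp only: sum_distrib_right[symmetric] cnt Pow_iff)
  also have "\<dots> = (\<Sum>k\<le>p. \<Sum>S\<in>{S\<in>Pow {..<p}. card S = k}. fact (p - card S) * z ^ card S)"
    by (rule sum.group[symmetric]) (auto dest: card_mono[rotated])
  also have "\<dots> = (\<Sum>k\<le>p. real (p choose k) * (fact (p - k) * z ^ k))"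
    by (intro sum.cong refl) (simp add: n_subsets Pow_def)
  \<comment> \<open>The \<open>k\<close>-subsets contribute
    \<open>(p choose k) * fact (p - k) = fact p / fact k\<close>, leaving a partial exponential
    series.\<close>
  also have "\<dots> = fact p * (\<Sum>k\<le>p. z ^ k / fact k)"
    unfolding sum_distrib_left by (intro sum.cong refl) (simp add: binomial_fact field_simps)
  also have "\<dots> \<le> fact p * exp z"
    using exp_ge_partial_sum[OF assms] by (intro mult_left_mono) auto
  finally show ?thesis .
qed

text \<open>Substituting \<open>\<pi>' = \<pi> \<circ> \<tau>\<close> turns agreements into fixed
  points of \<tau>, so the inner sum does not depend on \<pi>.\<close>

lemma sum_permutes_agree:
  fixes f :: "nat \<Rightarrow> real"
  shows "(\<Sum>\<pi> | \<pi> permutes {..<p}. \<Sum>\<pi>' | \<pi>' permutes {..<p}. f (card {i. i < p \<and> \<pi> i = \<pi>' i}))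
    = fact p * (\<Sum>\<pi> | \<pi> permutes {..<p}. f (card {i. i < p \<and> \<pi> i = i}))"
proof -
  have "(\<Sum>\<pi>' | \<pi>' permutes {..<p}. f (card {i. i < p \<and> \<pi> i = \<pi>' i}))
    = (\<Sum>\<pi> | \<pi> permutes {..<p}. f (card {i. i < p \<and> \<pi> i = i}))" if \<pi>: "\<pi> permutes {..<p}" for \<pi>
  proof -
    have "(\<pi> i = (\<pi> \<circ> \<tau>) i) = (\<tau> i = i)" for \<tau> i
      using permutes_inj[OF \<pi>] by (auto simp: inj_eq)
    then show ?thesis
      using setum_permutations_compose_left[OF \<pi>, of "\<lambda>\<pi>'. f (card {i. i < p \<and> \<pi> i = \<pi>' i})"]
      by (simp del: comp_apply)
  qed
  then show ?thesis by (simp add: card_permutations)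
qed

text \<open>From \<open>1 + x \<le> exp x\<close>, the \<open>n\<close>-th power at \<open>c\<close>
  agreements is at most \<open>exp (n * a) ^ c\<close>, which is the generating function of fixed
  points at \<open>z = exp (n * a) - 1\<close>.\<close>

lemma agreement_moment:
  fixes a :: real
  assumes "a \<ge> 0"
  shows "(\<Sum>\<pi> | \<pi> permutes {..<p}. \<Sum>\<pi>' | \<pi>' permutes {..<p}. (1 + a * card {i. i < p \<and> \<pi> i = \<pi>' i}) ^ n)
    \<le> (fact p)\<^sup>2 * exp (exp (n * a) - 1)"
proof -
  define z where "z = exp (n * a) - 1"
  have z: "z \<ge> 0" using assms by (simp add: z_def)
  have le: "(1 + a * real c) ^ n \<le> (1 + z) ^ c" for c
  proof -
    have "(1 + a * real c) ^ n \<le> exp (a * real c) ^ n"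
      using assms by (intro power_mono exp_ge_add_one_self) auto
    also have "\<dots> = (1 + z) ^ c"
      by (simp add: z_def exp_of_nat_mult[symmetric] mult_ac)
    finally show ?thesis .
  qed
  have "(\<Sum>\<pi> | \<pi> permutes {..<p}. \<Sum>\<pi>' | \<pi>' permutes {..<p}. (1 + a * card {i. i < p \<and> \<pi> i = \<pi>' i}) ^ n)
    = fact p * (\<Sum>\<pi> | \<pi> permutes {..<p}. (1 + a * card {i. i < p \<and> \<pi> i = i}) ^ n)"
    by (rule sum_permutes_agree)
  also have "\<dots> \<le> fact p * (\<Sum>\<pi> | \<pi> permutes {..<p}. (1 + z) ^ card {i. i < p \<and> \<pi> i = i})"
    by (intro mult_left_mono sum_mono le) auto
  also have "\<dots> \<le> fact p * (fact p * exp z)"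
    using sum_permutes_fixpoints[OF z] by (intro mult_left_mono) auto
  finally show ?thesis by (simp add: z_def power2_eq_square)
qed

section \<open>The two lower bounds\<close>

lemma scalar_mat_eq_pairing_mat:
  "of_real c \<cdot>\<^sub>m 1\<^sub>m d = pairing_mat d q g c c c"
  by (rule eq_matI) (auto simp: pairing_mat_def pairing_entry_def)

lemma crank_scalar_mat:
  assumes "c \<noteq> 0"
  shows "crank (c \<cdot>\<^sub>m 1\<^sub>m d) = d"
  using assms vec_space.det_rank_iff[of "c \<cdot>\<^sub>m 1\<^sub>m d" d] by (simp add: crank_def)

lemma crank_le: "A \<in> carrier_mat d d \<Longrightarrow> crank A \<le> d"
  using vec_space.rank_le_nc[of A d d] by (simp add: crank_def)

lemma density_pairing_mat:
  assumes "pairing q g" "q \<le> d" "u \<ge> 0" "w \<ge> 0" "z \<ge> 0"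
    and "real q * ((u + w) / 2) + (real d - real q) * z = 1"
  shows "density d (pairing_mat d q g u w z)"
  unfolding density_def mtrace_pairing_mat[OF assms(1,2)] assms(6)
  using psd_pairing_mat[OF assms(1-5)] by simp

text \<open>The scalar matrix belongs to the same family for any \<open>g\<close>, so roots and
  product are taken on eigenvalues.\<close>

lemma hellinger_pairing_mat:
  assumes "pairing q g" "q \<le> d" "u \<ge> 0" "w \<ge> 0" "z \<ge> 0"
  shows "hellinger (pairing_mat d q g (u / d) (w / d) (z / d)) (of_real (1 / d) \<cdot>\<^sub>m 1\<^sub>m d)
    = sqrt (1 - (real q * ((sqrt u + sqrt w) / 2) + (real d - real q) * sqrt z) / d)"
proof -
  have s: "sqrt (x / d) * sqrt (1 / d) = sqrt x / d" for x
    by (simp add: real_sqrt_divide)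
  have "mtrace (msqrt (pairing_mat d q g (u / d) (w / d) (z / d)) * msqrt (pairing_mat d q g (1 / d) (1 / d) (1 / d)))
    = of_real (real q * ((sqrt u / d + sqrt w / d) / 2) + (real d - real q) * (sqrt z / d))"
    using assms by (simp only: msqrt_pairing_mat divide_nonneg_nonneg of_nat_0_le_iff zero_le_one
      pairing_mat_mult mtrace_pairing_mat s)
  also have "real q * ((sqrt u / d + sqrt w / d) / 2) + (real d - real q) * (sqrt z / d)
    = (real q * ((sqrt u + sqrt w) / 2) + (real d - real q) * sqrt z) / d"
    by (simp add: add_divide_distrib distrib_left)
  finally show ?thesis unfolding hellinger_def scalar_mat_eq_pairing_mat[of _ d q g] by simp
qed

text \<open>Squaring the left side gives \<open>2 + 2 * sqrt (1 - x^2)\<close>, which is at most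
  \<open>4 - x^2\<close>. The quadratic gap below \<open>2\<close> keeps the perturbed states far
  from \<sigma>.\<close>

lemma sqrt_sum_le:
  assumes "0 \<le> x" "x \<le> 1"
  shows "sqrt (1 + x) + sqrt (1 - x) \<le> 2 - x\<^sup>2 / 4"
proof -
  have "sqrt (1 - x\<^sup>2) \<le> 1 - x\<^sup>2 / 2"
  proof (rule real_le_lsqrt)
    have "x\<^sup>2 \<le> 1" using assms by (simp add: power_le_one)
    then show "0 \<le> 1 - x\<^sup>2 / 2" by simp
    have "(1 - x\<^sup>2 / 2)\<^sup>2 = 1 - x\<^sup>2 + (x\<^sup>2 / 2)\<^sup>2" by (simp add: power2_diff)
    then show "1 - x\<^sup>2 \<le> (1 - x\<^sup>2 / 2)\<^sup>2" by simp
  qed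
  moreover have "sqrt (1 + x) * sqrt (1 - x) = sqrt (1 - x\<^sup>2)"
    by (simp add: real_sqrt_mult[symmetric] algebra_simps power2_eq_square)
  ultimately have "(sqrt (1 + x) + sqrt (1 - x))\<^sup>2 \<le> 4 - x\<^sup>2"
    using assms by (simp add: power2_sum)
  also have "\<dots> \<le> (2 - x\<^sup>2 / 4)\<^sup>2"
  proof -
    have "(2 - x\<^sup>2 / 4)\<^sup>2 = 4 - x\<^sup>2 + (x\<^sup>2 / 4)\<^sup>2" by (simp add: power2_diff)
    then show ?thesis by simp
  qed
  finally show ?thesis
  proof (rule power2_le_imp_le)
    have "x\<^sup>2 \<le> 1" using assms by (simp add: power_le_one)
    then show "0 \<le> 2 - x\<^sup>2 / 4" by simp
  qed
qed

lemma hellinger_lower_bound_mixed: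
  assumes r: "r \<ge> 2" and \<epsilon>: "0 < \<epsilon>" "7 * \<epsilon> \<le> 1"
    and est: "hellinger_estimator r (of_real (1 / r) \<cdot>\<^sub>m 1\<^sub>m r) r \<epsilon> n m E est"
  shows "real n \<ge> 1/500 * real r / \<epsilon>\<^sup>2"
proof (rule ccontr)
  assume "\<not> real n \<ge> 1/500 * real r / \<epsilon>\<^sup>2"
  then have small: "real n * \<epsilon>\<^sup>2 / r < 1/500" using \<epsilon> r by (simp add: field_simps)
  \<comment> \<open>The factor must satisfy \<open>4 * \<epsilon>^2 < \<delta>^2 / 12\<close> for
    the distance to exceed \<open>2 * \<epsilon>\<close>; \<open>7\<close> is the least integer that
    does.\<close>
  define \<delta> where "\<delta> = 7 * \<epsilon>"
  have \<delta>: "0 < \<delta>" "\<delta> \<le> 1" using \<epsilon> by (auto simp: \<delta>_def)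
  define p where "p = r div 2"
  \<comment> \<open>The second bound is tight at \<open>r = 3\<close>, where one of three
    coordinates is unmatched.\<close>
  have p: "2 * p \<le> r" "r \<le> 3 * p" using r by (auto simp: p_def)
  define P where "P = {\<pi>. \<pi> permutes {..<p}}"
  have "id \<in> P" by (simp add: P_def permutes_id)
  then have P: "finite P" "P \<noteq> {}" "card P = fact p"
    using finite_permutations[of "{..<p}"] card_permutations[of "{..<p}" p] by (auto simp flip: P_def)
  have pair: "pairing (2 * p) (matching p \<pi>)" if "\<pi> \<in> P" for \<pi>
    using that pairing_matching by (simp add: P_def)
  \<comment> \<open>An arbitrary reference permutation, used to name the common distance
    \<open>h\<close> and to write \<sigma> as a pairing matrix.\<close>
  obtain \<iota> where \<iota>: "\<iota> \<in> P" using P(2) by blast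
  define \<sigma> where "\<sigma> = complex_of_real (1 / r) \<cdot>\<^sub>m 1\<^sub>m r"
  define \<rho> where "\<rho> \<pi> = pairing_mat r (2 * p) (matching p \<pi>) ((1 + \<delta>) / r) ((1 - \<delta>) / r) (1 / r)" for \<pi>
  define h where "h = hellinger (\<rho> \<iota>) \<sigma>"
  have heq: "hellinger (\<rho> \<pi>) \<sigma> =
      sqrt (1 - (real (2 * p) * ((sqrt (1 + \<delta>) + sqrt (1 - \<delta>)) / 2) + (real r - real (2 * p)) * sqrt 1) / r)"
    if "\<pi> \<in> P" for \<pi>
    unfolding \<rho>_def \<sigma>_def using hellinger_pairing_mat[OF pair[OF that] p(1), of "1 + \<delta>" "1 - \<delta>" 1] \<delta> by simp
  have h: "hellinger (\<rho> \<pi>) \<sigma> = h" if "\<pi> \<in> P" for \<pi>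
    unfolding h_def heq[OF that] heq[OF \<iota>] ..
  have dens: "density r (\<rho> \<pi>)" if "\<pi> \<in> P" for \<pi>
    unfolding \<rho>_def using \<delta> r p(1)
    by (intro density_pairing_mat[OF pair[OF that] p(1)]) (auto simp: field_simps)
  have \<sigma>eq: "\<sigma> = pairing_mat r (2 * p) (matching p \<iota>) (1 / r) (1 / r) (1 / r)"
    unfolding \<sigma>_def by (rule scalar_mat_eq_pairing_mat)
  have dens\<sigma>: "density r \<sigma>"
    unfolding \<sigma>eq using r p(1)
    by (intro density_pairing_mat[OF pair[OF \<iota>] p(1)]) (auto simp: field_simps)
  have rank: "crank \<sigma> \<le> r" "crank (\<rho> \<pi>) \<le> r" for \<pi>
    by (intro crank_le; simp add: \<sigma>_def \<rho>_def pairing_mat_def)+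
  have h0: "hellinger \<sigma> \<sigma> = 0"
    using hellinger_pairing_mat[OF pair[OF \<iota>] p(1), of 1 1 1] r
    unfolding \<sigma>eq[symmetric] \<sigma>_def[symmetric] by simp
  have hgt: "2 * \<epsilon> < h"
    unfolding h_def heq[OF \<iota>]
  proof (rule real_less_rsqrt)
    define S where "S = sqrt (1 + \<delta>) + sqrt (1 - \<delta>)"
    have S: "2 - S \<ge> \<delta>\<^sup>2 / 4" using sqrt_sum_le[of \<delta>] \<delta> by (simp add: S_def)
    have "(2 * \<epsilon>)\<^sup>2 < 1/3 * (\<delta>\<^sup>2 / 4)" using \<epsilon> by (simp add: \<delta>_def power_mult_distrib)
    also have "\<dots> \<le> real p / r * (2 - S)"
      using S p(2) r by (intro mult_mono) (auto simp: field_simps)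
    also have "\<dots> = 1 - (real (2 * p) * (S / 2) + (real r - real (2 * p)) * sqrt 1) / r"
      using r by (simp add: field_simps)
    finally show "(2 * \<epsilon>)\<^sup>2 < 1 - (real (2 * p) * ((sqrt (1 + \<delta>) + sqrt (1 - \<delta>)) / 2)
      + (real r - real (2 * p)) * sqrt 1) / r" unfolding S_def .
  qed
  have mtr: "Re (mtrace (A * tensor_pow r n \<sigma>)) = Re (mtrace A) / r ^ n"
    if "A \<in> carrier_mat (r ^ n) (r ^ n)" for A
    unfolding \<sigma>_def mtrace_mult_tensor_pow_scalar[OF that]
    by (simp only: of_real_power[symmetric] times_complex.sel Re_complex_of_real Im_complex_of_real)
      (simp add: power_inverse divide_inverse)
  have pos: "0 \<le> Re (mtrace (A * tensor_pow r n \<sigma>))" if A: "psd (r ^ n) A" for A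
  proof -
    show ?thesis unfolding mtr[OF psd_carrier[OF A]] using psd_mtrace_nonneg[OF A] by simp
  qed
  from est[folded \<sigma>_def] obtain F where F: "psd (r ^ n) F"
      "\<And>x. Re (qform (r ^ n) F x) \<le> (\<Sum>i<r ^ n. (cmod (x i))\<^sup>2)"
    and null: "Re (mtrace (F * tensor_pow r n \<sigma>)) \<le> 1/3"
    and alt: "\<And>\<rho>. density r \<rho> \<Longrightarrow> crank \<rho> \<le> r \<Longrightarrow> hellinger \<rho> \<sigma> = h \<Longrightarrow> Re (mtrace (F * tensor_pow r n \<rho>)) \<ge> 2/3"
    using hellinger_estimator_test[OF _ dens\<sigma> rank(1) h0 pos hgt] by metis
  let ?e = "\<lambda>\<pi>. pairing_entry (2 * p) (matching p \<pi>) ((1 + \<delta>) / r) ((1 - \<delta>) / r) (1 / r)"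
  define T where "T \<pi> i j = (\<Prod>k<n. ?e \<pi> ((i div r ^ k) mod r) ((j div r ^ k) mod r))" for \<pi> i j
  have T: "tensor_pow r n (\<rho> \<pi>) $$ (i,j) = of_real (T \<pi> i j)" if "i < r ^ n" "j < r ^ n" for \<pi> i j
    using that r by (simp add: tensor_pow_def \<rho>_def pairing_mat_def T_def)
  have "4/3 * (real (card P))\<^sup>2
    \<le> (\<Sum>\<pi>\<in>P. \<Sum>\<pi>'\<in>P. (r ^ n) * (\<Sum>i<r ^ n. \<Sum>j<r ^ n. T \<pi> i j * T \<pi>' i j))"
  proof (rule mixture_second_moment[OF _ P(1,2) F])
    show "0 < r ^ n" using r by simp
    show "Re (mtrace F) / real (r ^ n) \<le> 1/3" using null unfolding mtr[OF psd_carrier[OF F(1)]] by simp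
    fix \<pi> assume \<pi>: "\<pi> \<in> P"
    have "Re (mtrace (F * tensor_pow r n (\<rho> \<pi>))) = (\<Sum>i<r ^ n. \<Sum>j<r ^ n. Re (F $$ (i,j)) * T \<pi> j i)"
      unfolding mtrace_mult[OF psd_carrier[OF F(1)] tensor_pow_carrier] by (simp add: T)
    \<comment> \<open>The trace pairs \<open>F\<close> with the transpose of \<open>T \<pi>\<close>,
      which is symmetric.\<close>
    also have "\<dots> = (\<Sum>i<r ^ n. \<Sum>j<r ^ n. Re (F $$ (i,j)) * T \<pi> i j)"
    proof -
      have "T \<pi> j i = T \<pi> i j" for i j
        unfolding T_def by (intro prod.cong refl pairing_entry_sym[OF pair[OF \<pi>]])
      then show ?thesis by simp
    qed
    finally show "2/3 \<le> (\<Sum>i<r ^ n. \<Sum>j<r ^ n. Re (F $$ (i,j)) * T \<pi> i j)"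
      using alt[OF dens[OF \<pi>] rank(2) h[OF \<pi>]] by simp
    have "mtrace (tensor_pow r n (\<rho> \<pi>)) = 1"
      using dens[OF \<pi>] by (subst mtrace_tensor_pow) (auto simp: density_def psd_carrier)
    moreover have "mtrace (tensor_pow r n (\<rho> \<pi>)) = of_real (\<Sum>i<r ^ n. T \<pi> i i)"
      using tensor_pow_carrier[of r n "\<rho> \<pi>"] by (simp add: mtrace_def T)
    ultimately show "(\<Sum>i<r ^ n. T \<pi> i i) = 1" using of_real_eq_1_iff by metis
  qed
  also have "\<dots> = (\<Sum>\<pi>\<in>P. \<Sum>\<pi>'\<in>P. (1 + (2 * \<delta>\<^sup>2 / r) * card {i. i < p \<and> \<pi> i = \<pi>' i}) ^ n)"
  proof (intro sum.cong refl)
    fix \<pi> \<pi>' assume \<pi>: "\<pi> \<in> P" "\<pi>' \<in> P"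
    define C where "C = card {i. i < p \<and> \<pi> i = \<pi>' i}"
    have "card {i. i < 2 * p \<and> matching p \<pi> i = matching p \<pi>' i} = 2 * C"
      unfolding C_def using card_matching_agree \<pi> by (simp add: P_def)
    \<comment> \<open>Every diagonal entry is \<open>1 / r\<close>, matched or not, and every
      matching entry is \<open>\<delta> / r\<close>.\<close>
    then have "(\<Sum>a<r. \<Sum>b<r. ?e \<pi> a b * ?e \<pi>' a b)
        = real (2 * p) * (1 / r)\<^sup>2 + (\<delta> / r)\<^sup>2 * real (2 * C) + (real r - real (2 * p)) * (1 / r)\<^sup>2"
      unfolding pairing_entry_inner[OF pair[OF \<pi>(1)] pair[OF \<pi>(2)] p(1)]
      by (simp add: add_divide_distrib[symmetric] diff_divide_distrib[symmetric])
    also have "\<dots> = (1 + (2 * \<delta>\<^sup>2 / r) * C) / r"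
      using r by (simp add: field_simps power2_eq_square)
    finally have e: "(\<Sum>a<r. \<Sum>b<r. ?e \<pi> a b * ?e \<pi>' a b) = (1 + (2 * \<delta>\<^sup>2 / r) * C) / r" .
    have "(\<Sum>i<r ^ n. \<Sum>j<r ^ n. T \<pi> i j * T \<pi>' i j) = (\<Sum>a<r. \<Sum>b<r. ?e \<pi> a b * ?e \<pi>' a b) ^ n"
      unfolding T_def prod.distrib[symmetric] by (rule sum_prod_digits2[where f = "\<lambda>a b. ?e \<pi> a b * ?e \<pi>' a b"])
    then show "(r ^ n) * (\<Sum>i<r ^ n. \<Sum>j<r ^ n. T \<pi> i j * T \<pi>' i j)
      = (1 + (2 * \<delta>\<^sup>2 / r) * card {i. i < p \<and> \<pi> i = \<pi>' i}) ^ n"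
      unfolding e C_def[symmetric] using r by (simp add: power_divide)
  qed
  also have "\<dots> \<le> (fact p)\<^sup>2 * exp (exp (n * (2 * \<delta>\<^sup>2 / r)) - 1)"
    unfolding P_def by (rule agreement_moment) simp
  finally have "4/3 \<le> exp (exp (n * (2 * \<delta>\<^sup>2 / r)) - 1)"
    unfolding P(3) by simp
  \<comment> \<open>Here \<open>2 * 49 / 500 < 1/5\<close>. The next two estimates use
    \<open>exp x \<le> 1 + x + x^2\<close>, and the constant \<open>1/500\<close> is chosen so that
    the chain stays below \<open>4/3\<close>.\<close>
  moreover have "exp (n * (2 * \<delta>\<^sup>2 / r)) \<le> exp (1/5)"
    using small by (simp add: \<delta>_def power_mult_distrib field_simps)
  moreover have "exp (1/5 :: real) \<le> 1 + 6/25" using exp_bound[of "1/5"] by (simp add: power2_eq_square)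
  moreover have "exp (6/25 :: real) < 4/3" using exp_bound[of "6/25"] by (simp add: power2_eq_square)
  ultimately show False by (smt (verit) exp_le_cancel_iff)
qed

section \<open>Pure states and the rank-one case\<close>

definition pure :: "nat \<Rightarrow> (nat \<Rightarrow> real) \<Rightarrow> complex mat" where
  "pure d v = mat d d (\<lambda>(i,j). of_real (v i * v j))"

lemma pure_carrier: "pure d v \<in> carrier_mat d d"
  by (simp add: pure_def)

lemma mtrace_pure_mult: "mtrace (pure d v * pure d w) = of_real ((\<Sum>i<d. v i * w i)\<^sup>2)"
  unfolding mtrace_mult[OF pure_carrier pure_carrier]
  by (simp add: pure_def power2_eq_square sum_product mult_ac)

lemma pure_idem:
  assumes "(\<Sum>i<d. (v i)\<^sup>2) = 1"
  shows "pure d v * pure d v = pure d v"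
proof (rule eq_matI)
  fix i j assume "i < dim_row (pure d v)" "j < dim_col (pure d v)"
  then have ij: "i < d" "j < d" by (auto simp: pure_def)
  have "(pure d v * pure d v) $$ (i,j) = of_real (\<Sum>k<d. v i * v k * (v k * v j))"
    unfolding mult_mat_index[OF pure_carrier pure_carrier ij] using ij by (simp add: pure_def)
  also have "(\<Sum>k<d. v i * v k * (v k * v j)) = (\<Sum>k<d. (v k)\<^sup>2) * (v i * v j)"
    unfolding sum_distrib_right by (intro sum.cong refl) (simp add: power2_eq_square mult_ac)
  finally show "(pure d v * pure d v) $$ (i,j) = pure d v $$ (i,j)"
    using assms ij by (simp add: pure_def)
qed (auto simp: pure_def)

lemma psd_pure:
  assumes "(\<Sum>i<d. (v i)\<^sup>2) = 1"
  shows "psd d (pure d v)"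
  by (subst pure_idem[OF assms, symmetric])
    (intro psd_square pure_carrier, simp add: pure_def)

lemma density_pure:
  assumes "(\<Sum>i<d. (v i)\<^sup>2) = 1"
  shows "density d (pure d v)"
proof -
  have "mtrace (pure d v) = of_real (\<Sum>i<d. (v i)\<^sup>2)"
    by (simp add: mtrace_def pure_def power2_eq_square)
  then show ?thesis using psd_pure[OF assms] assms by (simp add: density_def)
qed

text \<open>A projection is its own square root, so the trace is the squared overlap.\<close>

lemma hellinger_pure:
  assumes "(\<Sum>i<d. (v i)\<^sup>2) = 1" "(\<Sum>i<d. (w i)\<^sup>2) = 1"
  shows "hellinger (pure d v) (pure d w) = sqrt (1 - (\<Sum>i<d. v i * w i)\<^sup>2)"
  unfolding hellinger_def msqrt_eqI[OF psd_pure[OF assms(1)] pure_idem[OF assms(1)]]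
    msqrt_eqI[OF psd_pure[OF assms(2)] pure_idem[OF assms(2)]] mtrace_pure_mult
  by (simp only: Re_complex_of_real)

lemma crank_pure_le: "crank (pure d v) \<le> 1"
  unfolding crank_def
  using vec_space.rank_le_1_product_entries[of "pure d v" d d "\<lambda>i. of_real (v i)" "\<lambda>i. of_real (v i)"]
  by (simp add: pure_def)

text \<open>Two projections of rank at most one add up to the identity of rank two, so subadditivity
  forces both ranks to be one.\<close>

lemma crank_pure_basis: "crank (pure 2 (\<lambda>i. of_bool (i = 0))) = 1"
proof -
  let ?a = "pure 2 (\<lambda>i. of_bool (i = 0))" and ?b = "pure 2 (\<lambda>i. of_bool (i = 1))"
  have "?a + ?b = 1\<^sub>m 2"
    by (rule eq_matI) (auto simp: pure_def less_2_cases_iff)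
  moreover have "vec_space.rank 2 (?a + ?b) \<le> vec_space.rank 2 ?a + vec_space.rank 2 ?b"
    by (rule vec_space.rank_subadditive[OF pure_carrier pure_carrier])
  moreover have "vec_space.rank 2 (1\<^sub>m 2 :: complex mat) = 2"
  proof -
    have "1 \<cdot>\<^sub>m 1\<^sub>m 2 = (1\<^sub>m 2 :: complex mat)" by (rule eq_matI) auto
    then show ?thesis using crank_scalar_mat[of 1 2] by (simp add: crank_def)
  qed
  ultimately show ?thesis
    using crank_pure_le[of 2 "\<lambda>i. of_bool (i = 0)"] crank_pure_le[of 2 "\<lambda>i. of_bool (i = 1)"]
    by (simp add: crank_def pure_def)
qed

text \<open>The tensor power of a pure state is the pure state of the product vector, so acceptance
  probabilities are values of the form of \<open>A\<close>.\<close>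

lemma mtrace_mult_tensor_pow_pure:
  assumes "A \<in> carrier_mat (d ^ n) (d ^ n)" "d > 0"
  shows "mtrace (A * tensor_pow d n (pure d v))
    = qform (d ^ n) A (\<lambda>i. of_real (\<Prod>k<n. v ((i div d ^ k) mod d)))"
  unfolding mtrace_mult[OF assms(1) tensor_pow_carrier] qform_def
  using assms(2) by (intro sum.cong refl) (simp add: tensor_pow_def pure_def prod.distrib mult_ac)

text \<open>A test separating the product vectors \<open>V\<close> and \<open>W\<close> forces their
  squared distance to be at least \<open>1/18\<close>. That distance is
  \<open>2 - 2 * c ^ n\<close>, which is at most \<open>18 * n * \<epsilon>^2\<close>, so
  \<open>n\<close> is at least \<open>1 / (324 * \<epsilon>^2)\<close>.\<close>

lemma hellinger_lower_bound_pure: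
  assumes \<epsilon>: "0 < \<epsilon>" "3 * \<epsilon> \<le> 1"
    and est: "hellinger_estimator 2 (pure 2 (\<lambda>i. of_bool (i = 0))) 1 \<epsilon> n m E est"
  shows "real n \<ge> 1/500 / \<epsilon>\<^sup>2"
proof -
  define c where "c = sqrt (1 - (3 * \<epsilon>)\<^sup>2)"
  have sq: "(3 * \<epsilon>)\<^sup>2 \<le> 1" by (rule power_le_one) (use \<epsilon> in auto)
  have c: "0 \<le> c" "c \<le> 1" "c\<^sup>2 = 1 - (3 * \<epsilon>)\<^sup>2" using sq by (auto simp: c_def)
  define v w :: "nat \<Rightarrow> real" where "v i = of_bool (i = 0)" and "w i = (if i = 0 then c else 3 * \<epsilon>)" for i
  have two: "(\<Sum>i<2. f i) = f 0 + f 1" for f :: "nat \<Rightarrow> real" by (simp add: numeral_2_eq_2)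
  have nv: "(\<Sum>i<2. (v i)\<^sup>2) = 1" and nw: "(\<Sum>i<2. (w i)\<^sup>2) = 1" and vw: "(\<Sum>i<2. w i * v i) = c"
    using c by (auto simp: two v_def w_def)
  have hvv: "hellinger (pure 2 v) (pure 2 v) = 0"
    using hellinger_pure[OF nv nv] nv by (simp add: power2_eq_square)
  have hwv: "hellinger (pure 2 w) (pure 2 v) = 3 * \<epsilon>"
  proof -
    have "sqrt (1 - c\<^sup>2) = 3 * \<epsilon>" by (rule real_sqrt_unique) (use c(3) \<epsilon> in auto)
    then show ?thesis using hellinger_pure[OF nw nv] unfolding vw by simp
  qed
  define V W where "V i = (\<Prod>k<n. v ((i div 2 ^ k) mod 2))" and "W i = (\<Prod>k<n. w ((i div 2 ^ k) mod 2))" for i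
  have nV: "(\<Sum>i<2 ^ n. (V i)\<^sup>2) = 1" and nW: "(\<Sum>i<2 ^ n. (W i)\<^sup>2) = 1" and VW: "(\<Sum>i<2 ^ n. W i * V i) = c ^ n"
    using sum_prod_digits[where d = 2 and n = n and f = "\<lambda>_ a. (v a)\<^sup>2"]
      sum_prod_digits[where d = 2 and n = n and f = "\<lambda>_ a. (w a)\<^sup>2"]
      sum_prod_digits[where d = 2 and n = n and f = "\<lambda>_ a. w a * v a"]
    by (simp_all only: V_def W_def prod_power_distrib prod.distrib nv nw vw) simp_all
  have dist: "(\<Sum>i<2 ^ n. (W i - V i)\<^sup>2) = 2 - 2 * c ^ n"
    using nV nW VW by (simp add: power2_diff sum.distrib sum_subtractf sum_distrib_left[symmetric] mult.assoc)
  have pos: "0 \<le> Re (mtrace (A * tensor_pow 2 n (pure 2 v)))" if "psd (2 ^ n) A" for A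
    by (subst mtrace_mult_tensor_pow_pure) (auto intro: psd_carrier psd_qform_nonneg that)
  have gt: "2 * \<epsilon> < 3 * \<epsilon>" using \<epsilon> by simp
  have \<sigma>: "pure 2 (\<lambda>i. of_bool (i = 0)) = pure 2 v" by (simp add: v_def pure_def)
  from est[unfolded \<sigma>] obtain F where F: "psd (2 ^ n) F"
      "\<And>x. Re (qform (2 ^ n) F x) \<le> (\<Sum>i<2 ^ n. (cmod (x i))\<^sup>2)"
    and null: "Re (mtrace (F * tensor_pow 2 n (pure 2 v))) \<le> 1/3"
    and alt: "\<And>\<rho>. density 2 \<rho> \<Longrightarrow> crank \<rho> \<le> 1 \<Longrightarrow> hellinger \<rho> (pure 2 v) = 3 * \<epsilon>
      \<Longrightarrow> Re (mtrace (F * tensor_pow 2 n \<rho>)) \<ge> 2/3"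
    using hellinger_estimator_test[OF _ density_pure[OF nv] crank_pure_le hvv pos gt] by metis
  let ?q = "\<lambda>x. Re (qform (2 ^ n) F (\<lambda>i. complex_of_real (x i)))"
  have qV: "?q V \<le> 1/3"
    using null unfolding mtrace_mult_tensor_pow_pure[OF psd_carrier[OF F(1)] zero_less_numeral] V_def .
  have qW: "?q W \<ge> 2/3"
    using alt[OF density_pure[OF nw] crank_pure_le hwv]
    unfolding mtrace_mult_tensor_pow_pure[OF psd_carrier[OF F(1)] zero_less_numeral] W_def .
  define b where "b = Re (\<Sum>i<2 ^ n. \<Sum>j<2 ^ n. cnj (of_real (V i)) * F $$ (i,j) * of_real (W j))"
  have ex: "?q (\<lambda>i. W i - t * V i) = ?q W - 2 * t * b + t\<^sup>2 * ?q V" for t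
    using qform_diff[OF psd_hermitian[OF F(1)], where t = t and x = "\<lambda>i. of_real (W i)" and y = "\<lambda>i. of_real (V i)"]
    by (simp only: of_real_diff of_real_mult b_def)
  \<comment> \<open>This bounds the cross term \<open>b\<close>, giving
    \<open>?q W / 3 - ?q V / 2 \<ge> 2/9 - 1/6\<close> for the form at \<open>W - V\<close>. The
    factor \<open>3/2\<close> approximates the optimal \<open>sqrt 2\<close>, the root of the ratio
    of \<open>2/3\<close> to \<open>1/3\<close>.\<close>
  have "?q (\<lambda>i. W i - 3/2 * V i) \<ge> 0" by (rule psd_qform_nonneg[OF F(1)])
  then have "1/18 \<le> ?q (\<lambda>i. W i - 1 * V i)"
    unfolding ex using qV qW by (simp add: power2_eq_square)
  also have "\<dots> \<le> (\<Sum>i<2 ^ n. (W i - V i)\<^sup>2)"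
    using F(2)[of "\<lambda>i. of_real (W i - 1 * V i)"] by (simp only: norm_of_real power2_abs mult_1)
  also have "\<dots> \<le> 2 * (real n * (1 - c))"
    using Bernoulli_inequality[of "c - 1" n] c by (simp add: dist algebra_simps)
  also have "\<dots> \<le> 2 * (real n * (3 * \<epsilon>)\<^sup>2)"
  proof -
    have "c\<^sup>2 \<le> c" using mult_left_mono[of c 1 c] c(1,2) by (simp add: power2_eq_square)
    then have "1 - c \<le> (3 * \<epsilon>)\<^sup>2" using c(3) by simp
    then show ?thesis by (intro mult_left_mono) auto
  qed
  finally show ?thesis using \<epsilon> by (simp add: field_simps power2_eq_square)
qed

theorem mainTheorem13:
  shows "\<exists>c > 0. \<forall>(r::nat) (\<epsilon>::real). r \<ge> 1 \<and> 0 < \<epsilon> \<and> \<epsilon> < sqrt 2 / 12 \<longrightarrow>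
    (\<exists>d \<sigma>. density d \<sigma> \<and> crank \<sigma> = r \<and>
      (\<forall>n m E est. hellinger_estimator d \<sigma> r \<epsilon> n m E est \<longrightarrow>
         real n \<ge> c * real r / \<epsilon>\<^sup>2))"
proof (intro exI[of _ "1/500 :: real"] conjI allI impI)
  fix r :: nat and \<epsilon> :: real
  assume A: "r \<ge> 1 \<and> 0 < \<epsilon> \<and> \<epsilon> < sqrt 2 / 12"
  \<comment> \<open>Turns the bound on \<epsilon> into \<open>7 * \<epsilon> \<le> 1\<close>, which
    keeps \<open>1 - \<delta>\<close> nonnegative.\<close>
  have "sqrt 2 \<le> 12/7" by (rule real_le_lsqrt) (auto simp: power2_eq_square)
  then have \<epsilon>: "0 < \<epsilon>" "7 * \<epsilon> \<le> 1" using A by auto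
  show "\<exists>d \<sigma>. density d \<sigma> \<and> crank \<sigma> = r \<and>
      (\<forall>n m E est. hellinger_estimator d \<sigma> r \<epsilon> n m E est \<longrightarrow> real n \<ge> 1/500 * real r / \<epsilon>\<^sup>2)"
  \<comment> \<open>For \<open>r = 1\<close> the matching would be empty. The space then has
    dimension \<open>2\<close>, as in dimension \<open>1\<close> there is only one state.\<close>
  proof (cases "r = 1")
    case True
    have "density 2 (pure 2 (\<lambda>i. of_bool (i = 0)))"
      by (rule density_pure) (simp add: numeral_2_eq_2)
    then show ?thesis
      using hellinger_lower_bound_pure[of \<epsilon>] \<epsilon> crank_pure_basis True
      by (intro exI[of _ 2] exI[of _ "pure 2 (\<lambda>i. of_bool (i = 0))"]) auto
  next
    case False
    have "density r (of_real (1 / r) \<cdot>\<^sub>m 1\<^sub>m r)"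
      \<comment> \<open>The empty pairing, \<open>q = 0\<close>, leaves only the scalar
        part.\<close>
      unfolding scalar_mat_eq_pairing_mat[of "1 / r" r 0 id] using A
      by (intro density_pairing_mat) (auto simp: pairing_def)
    moreover have "crank (complex_of_real (1 / r) \<cdot>\<^sub>m 1\<^sub>m r) = r"
      using A by (intro crank_scalar_mat) auto
    ultimately show ?thesis
      using hellinger_lower_bound_mixed[of r \<epsilon>] \<epsilon> A False by fastforce
  qed
qed simp

end
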